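(* Let $\Gamma^-$ be a lower differential game satisfying the standing assumptions in the context. If $\Gamma^-$ is uniquely ergodic, then for every dominion $D^1\subset\mathbb{R}^n$ of player 1 and every dominion $D^2\subset\mathbb{R}^n$ of player 2 in $\Gamma^-$, $$\overline{\pi(D^1)}\cap\overline{\pi(D^2)}\neq\emptyset ,$$ i.e. every dominion of player 1 in the torus intersects every dominion of player 2 in the torus.
   Context: Setting (standing assumptions). $A,B$ are nonempty compact metric spaces, $|\cdot|$ is the Euclidean norm. $f:\mathbb{R}^n\times A\times B\to\mathbb{R}^n$ is continuous, and there is $L_f\ge0$ with $|f(x,a,b)-f(y,a,b)|\le L_f|x-y|$ for all $x,y,a,b$. $\ell:\mathbb{R}^n\times A\times B\to\mathbb{R}$ is bounded and continuous, and there is a modulus of continuity $\omega_\ell$ (nondecreasing $[0,\infty)\to[0,\infty)$, vanishing and continuous at $0$) with $|\ell(x,a,b)-\ell(y,a,b)|\le\omega_\ell(|x-y|)$ for all $x,y,a,b$. Both $f$ and $\ell$ are $\mathbb{Z}^n$-periodic in $x$. $\mathscr{A}$ (resp. $\mathscr{B}$) is the set of Lebesgue measurable functions $[0,+\infty)\to A$ (resp. $B$), called controls of player 1 (resp. 2). For $x\in\mathbb{R}^n$, $a\in\mathscr{A}$, $b\in\mathscr{B}$, $X^{x,a,b}_t$ is the unique solution of $\dot X_t=f(X_t,a_t,b_t)$ for a.e. $t>0$, $X_0=x$. A nonanticipating strategy of player 1 is a map $\alpha:\mathscr{B}\to\mathscr{A}$ such that for all $t>0$ and $b^1,b^2\in\mathscr{B}$,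 if $b^1_s=b^2_s$ for a.e. $s\le t$ then $\alpha[b^1]_s=\alpha[b^2]_s$ for a.e. $s\le t$; $\mathfrak{A}$ is the set of these. Write $X^{x,\alpha,b}_t=X^{x,\alpha[b],b}_t$. The lower game $\Gamma^-$ with running payoff $\ell$ has discounted value, for $\delta>0$, $$v_\delta(x)=\inf_{\alpha\in\mathfrak{A}}\sup_{b\in\mathscr{B}}\int_0^\infty e^{-\delta s}\ell(X^{x,\alpha,b}_s,\alpha[b]_s,b_s)\,ds .$$ The game is ergodic if $\delta v_\delta(x)$ converges uniformly in $x$ to a constant as $\delta\to0$. It is uniquely ergodic if for every continuous $\mathbb{Z}^n$-periodic $g:\mathbb{R}^n\to\mathbb{R}$, the game with running payoff $(x,a,b)\mapsto\ell(x,a,b)+g(x)$, all other data being equal, is ergodic. For $K\subset\mathbb{R}^n$, $\operatorname{dist}_K(x)=\inf_{y\in K}|y-x|$. A dominion of player 1 in $\Gamma^-$ is a nonempty closed set $D\subset\mathbb{R}^n$ such that for all $x\in D$, $\varepsilon>0$, $T\ge0$ there is $\alpha\in\mathfrak{A}$ such that for all $b\in\mathscr{B}$ and $t\in[0,T]$, $\operatorname{dist}_D(X^{x,\alpha,b}_t)\le\varepsilon$. A dominion of player 2 in $\Gamma^-$ is a nonempty closed set $D\subset\mathbb{R}^n$ such that for all $x\in D$, $\varepsilon>0$, $T\ge0$ and all $\alpha\in\mathfrak{A}$ there is $b\in\mathscr{B}$ such that for all $t\in[0,T]$, $\operatorname{dist}_D(X^{x,\alpha,b}_t)\le\varepsilon$.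 $\pi:\mathbb{R}^n\to\mathbb{R}^n/\mathbb{Z}^n$ is the quotient map, and the overline denotes topological closure. A dominion in the torus of a player is a set $\overline{\pi(D)}$ with $D\subset\mathbb{R}^n$ a dominion of that player in $\Gamma^-$. *)

theory Defs
  imports "HOL-Analysis.Analysis"
begin

section \<open>The flat torus\<close>

definition int_lattice :: "(real ^ 'n) set" where
  "int_lattice = {k. \<forall>i. k $ i \<in> \<int>}"

definition lattice_equiv :: "real ^ 'n \<Rightarrow> real ^ 'n \<Rightarrow> bool" where
  "lattice_equiv x y \<longleftrightarrow> x - y \<in> int_lattice"

lemma equivp_lattice_equiv: "equivp (lattice_equiv :: real ^ 'n \<Rightarrow> real ^ 'n \<Rightarrow> bool)"
proof (rule equivpI)
  show "reflp (lattice_equiv :: real ^ 'n \<Rightarrow> real ^ 'n \<Rightarrow> bool)"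
    by (auto simp: reflp_def lattice_equiv_def int_lattice_def)
  show "symp (lattice_equiv :: real ^ 'n \<Rightarrow> real ^ 'n \<Rightarrow> bool)"
    by (auto simp: symp_def lattice_equiv_def int_lattice_def) (metis Ints_minus minus_diff_eq)
  show "transp (lattice_equiv :: real ^ 'n \<Rightarrow> real ^ 'n \<Rightarrow> bool)"
    unfolding transp_def
  proof (intro allI impI)
    fix x y z :: "real ^ 'n"
    assume "lattice_equiv x y" "lattice_equiv y z"
    then have "(x $ i - y $ i) + (y $ i - z $ i) \<in> \<int>" for i
      by (intro Ints_add) (simp_all add: lattice_equiv_def int_lattice_def)
    then show "lattice_equiv x z"
      by (simp add: lattice_equiv_def int_lattice_def)
  qed
qed

quotient_type (overloaded) 'n torus = "real ^ ('n :: finite)" / lattice_equiv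
  morphisms rep_torus torus_proj
  by (rule equivp_lattice_equiv)

instantiation torus :: (finite) topological_space
begin

text \<open>The quotient topology.\<close>

definition open_torus :: "'a torus set \<Rightarrow> bool" where
  "open_torus U \<longleftrightarrow> open (torus_proj -` U)"

instance
proof
  show "open (UNIV :: 'a torus set)"
    by (simp add: open_torus_def)
next
  fix S T :: "'a torus set"
  assume "open S" "open T"
  then show "open (S \<inter> T)"
    by (simp add: open_torus_def vimage_Int open_Int)
next
  fix K :: "'a torus set set"
  assume "\<forall>S\<in>K. open S"
  then show "open (\<Union>K)"
    by (auto simp: open_torus_def vimage_Union)
qed

end

lemma torus_proj_eq_iff: "torus_proj x = torus_proj y \<longleftrightarrow> x - y \<in> int_lattice"
  by (simp add: torus.abs_eq_iff lattice_equiv_def)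

section \<open>Differential games\<close>

definition lattice_periodic :: "(real ^ 'n \<Rightarrow> 'c) \<Rightarrow> bool" where
  "lattice_periodic h \<longleftrightarrow> (\<forall>x. \<forall>k\<in>int_lattice. h (x + k) = h x)"

definition modulus_of_continuity :: "(real \<Rightarrow> real) \<Rightarrow> bool" where
  "modulus_of_continuity w \<longleftrightarrow>
     mono_on {0..} w \<and> (\<forall>r\<ge>0. 0 \<le> w r) \<and> w 0 = 0 \<and> continuous (at 0 within {0..}) w"

locale differential_game =
  fixes A :: "'a::metric_space set" and B :: "'b::metric_space set"
    and f :: "real ^ 'n \<Rightarrow> 'a \<Rightarrow> 'b \<Rightarrow> real ^ 'n"
    and l :: "real ^ 'n \<Rightarrow> 'a \<Rightarrow> 'b \<Rightarrow> real"
  assumes compact_A: "compact A" and nonempty_A: "A \<noteq> {}"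
    and compact_B: "compact B" and nonempty_B: "B \<noteq> {}"
    and continuous_f: "continuous_on (UNIV \<times> A \<times> B) (\<lambda>(x, a, b). f x a b)"
    and lipschitz_f: "\<exists>L\<ge>0. \<forall>x y. \<forall>a\<in>A. \<forall>b\<in>B. norm (f x a b - f y a b) \<le> L * norm (x - y)"
    and periodic_f: "\<And>a b. a \<in> A \<Longrightarrow> b \<in> B \<Longrightarrow> lattice_periodic (\<lambda>x. f x a b)"
    and continuous_l: "continuous_on (UNIV \<times> A \<times> B) (\<lambda>(x, a, b). l x a b)"
    and bounded_l: "bounded ((\<lambda>(x, a, b). l x a b) ` (UNIV \<times> A \<times> B))"
    and modulus_l: "\<exists>w. modulus_of_continuity w \<and>
       (\<forall>x y. \<forall>a\<in>A. \<forall>b\<in>B. \<bar>l x a b - l y a b\<bar> \<le> w (norm (x - y)))"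
    and periodic_l: "\<And>a b. a \<in> A \<Longrightarrow> b \<in> B \<Longrightarrow> lattice_periodic (\<lambda>x. l x a b)"

text \<open>Functions of time live on \<open>[0, \<infinity>)\<close>; they are represented by functions on the reals
  that take the dummy value \<open>undefined\<close> at negative times.\<close>

definition controls :: "'c::topological_space set \<Rightarrow> (real \<Rightarrow> 'c) set" where
  "controls C = measurable (lebesgue_on {0..}) (restrict_space borel C) \<inter> extensional {0..}"

text \<open>In a division \<open>d\<close> the members are non-overlapping compact intervals
  \<open>k = [Inf k, Sup k]\<close>.\<close>

definition absolutely_continuous_interval ::
    "real \<Rightarrow> real \<Rightarrow> (real \<Rightarrow> 'v::real_normed_vector) \<Rightarrow> bool" where
  "absolutely_continuous_interval s t X \<longleftrightarrow>
     (\<forall>e>0. \<exists>\<delta>>0. \<forall>d. d division_of \<Union>d \<and> \<Union>d \<subseteq> {s..t} \<and> (\<Sum>k\<in>d. Sup k - Inf k) < \<delta> \<longrightarrow>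
        (\<Sum>k\<in>d. norm (X (Sup k) - X (Inf k))) < e)"

text \<open>Solutions are understood in the sense of Caratheodory, that is, locally absolutely
  continuous; without this the equation for almost every time would not determine them.\<close>

definition is_trajectory ::
    "(real ^ 'n \<Rightarrow> 'a \<Rightarrow> 'b \<Rightarrow> real ^ 'n) \<Rightarrow> real ^ 'n \<Rightarrow> (real \<Rightarrow> 'a) \<Rightarrow> (real \<Rightarrow> 'b)
      \<Rightarrow> (real \<Rightarrow> real ^ 'n) \<Rightarrow> bool" where
  "is_trajectory f x a b X \<longleftrightarrow>
     X \<in> extensional {0..} \<and> X 0 = x \<and>
     (\<forall>T\<ge>0. absolutely_continuous_interval 0 T X) \<and>
     (AE t in lebesgue. t > 0 \<longrightarrow> (X has_vector_derivative f (X t) (a t) (b t)) (at t))"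

definition trajectory ::
    "(real ^ 'n \<Rightarrow> 'a \<Rightarrow> 'b \<Rightarrow> real ^ 'n) \<Rightarrow> real ^ 'n \<Rightarrow> (real \<Rightarrow> 'a) \<Rightarrow> (real \<Rightarrow> 'b)
      \<Rightarrow> real \<Rightarrow> real ^ 'n" where
  "trajectory f x a b = (THE X. is_trajectory f x a b X)"

definition strategies ::
    "'a::topological_space set \<Rightarrow> 'b::topological_space set \<Rightarrow> ((real \<Rightarrow> 'b) \<Rightarrow> real \<Rightarrow> 'a) set" where
  "strategies A B =
     {\<alpha> \<in> controls B \<rightarrow> controls A.
        \<forall>t>0. \<forall>b1\<in>controls B. \<forall>b2\<in>controls B.
          (AE s\<in>{0..t} in lebesgue. b1 s = b2 s) \<longrightarrow> (AE s\<in>{0..t} in lebesgue. \<alpha> b1 s = \<alpha> b2 s)}"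

definition discounted_payoff ::
    "(real ^ 'n \<Rightarrow> 'a \<Rightarrow> 'b \<Rightarrow> real ^ 'n) \<Rightarrow> (real ^ 'n \<Rightarrow> 'a \<Rightarrow> 'b \<Rightarrow> real)
      \<Rightarrow> real \<Rightarrow> real ^ 'n \<Rightarrow> (real \<Rightarrow> 'a) \<Rightarrow> (real \<Rightarrow> 'b) \<Rightarrow> real" where
  "discounted_payoff f l \<delta> x a b =
     (LINT s:{0..}|lebesgue. exp (- \<delta> * s) * l (trajectory f x a b s) (a s) (b s))"

definition lower_value ::
    "'a::topological_space set \<Rightarrow> 'b::topological_space set
      \<Rightarrow> (real ^ 'n \<Rightarrow> 'a \<Rightarrow> 'b \<Rightarrow> real ^ 'n) \<Rightarrow> (real ^ 'n \<Rightarrow> 'a \<Rightarrow> 'b \<Rightarrow> real)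
      \<Rightarrow> real \<Rightarrow> real ^ 'n \<Rightarrow> real" where
  "lower_value A B f l \<delta> x =
     (INF \<alpha>\<in>strategies A B. SUP b\<in>controls B. discounted_payoff f l \<delta> x (\<alpha> b) b)"

definition ergodic ::
    "'a::topological_space set \<Rightarrow> 'b::topological_space set
      \<Rightarrow> (real ^ 'n \<Rightarrow> 'a \<Rightarrow> 'b \<Rightarrow> real ^ 'n) \<Rightarrow> (real ^ 'n \<Rightarrow> 'a \<Rightarrow> 'b \<Rightarrow> real) \<Rightarrow> bool" where
  "ergodic A B f l \<longleftrightarrow>
     (\<exists>c. uniform_limit UNIV (\<lambda>\<delta> x. \<delta> * lower_value A B f l \<delta> x) (\<lambda>_. c) (at_right 0))"

definition uniquely_ergodic ::
    "'a::topological_space set \<Rightarrow> 'b::topological_space set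
      \<Rightarrow> (real ^ 'n \<Rightarrow> 'a \<Rightarrow> 'b \<Rightarrow> real ^ 'n) \<Rightarrow> (real ^ 'n \<Rightarrow> 'a \<Rightarrow> 'b \<Rightarrow> real) \<Rightarrow> bool" where
  "uniquely_ergodic A B f l \<longleftrightarrow>
     (\<forall>g. continuous_on UNIV g \<and> lattice_periodic g \<longrightarrow>
        ergodic A B f (\<lambda>x a b. l x a b + g x))"

definition dominion1 ::
    "'a::topological_space set \<Rightarrow> 'b::topological_space set
      \<Rightarrow> (real ^ 'n \<Rightarrow> 'a \<Rightarrow> 'b \<Rightarrow> real ^ 'n) \<Rightarrow> (real ^ 'n) set \<Rightarrow> bool" where
  "dominion1 A B f D \<longleftrightarrow>
     D \<noteq> {} \<and> closed D \<and>
     (\<forall>x\<in>D. \<forall>\<epsilon>>0. \<forall>T\<ge>0. \<exists>\<alpha>\<in>strategies A B. \<forall>b\<in>controls B. \<forall>t\<in>{0..T}.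
        infdist (trajectory f x (\<alpha> b) b t) D \<le> \<epsilon>)"

definition dominion2 ::
    "'a::topological_space set \<Rightarrow> 'b::topological_space set
      \<Rightarrow> (real ^ 'n \<Rightarrow> 'a \<Rightarrow> 'b \<Rightarrow> real ^ 'n) \<Rightarrow> (real ^ 'n) set \<Rightarrow> bool" where
  "dominion2 A B f D \<longleftrightarrow>
     D \<noteq> {} \<and> closed D \<and>
     (\<forall>x\<in>D. \<forall>\<epsilon>>0. \<forall>T\<ge>0. \<forall>\<alpha>\<in>strategies A B. \<exists>b\<in>controls B. \<forall>t\<in>{0..T}.
        infdist (trajectory f x (\<alpha> b) b t) D \<le> \<epsilon>)"

end

theory Submission
  imports Defs
begin

text \<open>
  Suppose that the closures of the projections of \<open>D1\<close> and \<open>D2\<close> are disjoint. Their inverse images in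
  the covering space are disjoint closed periodic sets, so there is a continuous periodic function \<open>g\<close>
  with \<open>g = 0\<close> near \<open>D1\<close> and \<open>g = 1\<close> near \<open>D2\<close> (\<open>periodic_Urysohn\<close>). Let \<open>\<bar>l\<bar> \<le> C\<close>, and consider the
  running payoff \<open>l + M * g\<close> with \<open>M = 2 * C + 1\<close>. Starting from a point of \<open>D1\<close>, player 1 (who minimises)
  can remain near \<open>D1\<close> for as long as desired, where the payoff is at most \<open>C\<close>; starting from a point of
  \<open>D2\<close>, player 2 can remain near \<open>D2\<close>, where the payoff is at least \<open>M - C = C + 1\<close>. Letting the horizon
  tend to infinity for a fixed discount rate \<open>\<delta>\<close>, the normalised value is at most \<open>C\<close> at the first point
  (\<open>lower_value_le_on_dominion1\<close>) and at least \<open>C + 1\<close> at the second (\<open>lower_value_ge_on_dominion2\<close>).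
  These values cannot approach a common constant as \<open>\<delta>\<close> tends to 0, so the perturbed game is not ergodic.

  The estimates of the values compare integrals, and this is meaningful only if trajectories are
  measurable in time. Hence it must be proved that the controlled differential equation has exactly one
  solution in the sense of Caratheodory for all measurable controls. The equation is turned into an
  integral equation (\<open>is_trajectory_iff_integral_equation\<close>), which a contraction argument solves
  (\<open>integral_equation_unique_solution\<close>). This translation rests on two facts of real analysis: an
  absolutely continuous function is the integral of its derivative, and an indefinite integral is
  differentiable almost everywhere with the expected derivative. Both follow from the gauge description
  of the integral, the second one together with the Vitali covering theorem.
\<close>

section \<open>Absolute continuity and almost everywhere differentiation\<close>

lemma sum_lengths_le_measure:
  fixes U :: "real set"
  assumes p: "p tagged_partial_division_of S" and sub: "\<And>x K. (x, K) \<in> p \<Longrightarrow> K \<subseteq> U"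
    and U: "U \<in> lmeasurable"
  shows "(\<Sum>K\<in>snd ` p. Sup K - Inf K) \<le> measure lebesgue U"
proof -
  note pD = tagged_partial_division_ofD[OF p]
  have p': "p tagged_division_of \<Union>(snd ` p)"
    by (rule tagged_partial_division_of_Union_self[OF p])
  have d: "snd ` p division_of \<Union>(snd ` p)"
    by (rule division_of_tagged_division[OF p'])
  have "(\<Sum>K\<in>snd ` p. Sup K - Inf K) = (\<Sum>K\<in>snd ` p. measure lebesgue K)"
  proof (rule sum.cong[OF refl])
    fix K assume "K \<in> snd ` p"
    then obtain x where x: "(x, K) \<in> p" by auto
    from pD(2,4)[OF x] obtain a b where "K = {a..b}" "x \<in> {a..b}" by (auto simp: box_real)
    then show "Sup K - Inf K = measure lebesgue K" by auto
  qed
  also have "\<dots> = measure lebesgue (\<Union>(snd ` p))"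
  proof (rule measure_negligible_finite_Union[symmetric])
    show "finite (snd ` p)" using pD(1) by simp
    show "K \<in> lmeasurable" if "K \<in> snd ` p" for K
      using that pD(4) by fastforce
    show "pairwise (\<lambda>K L. negligible (K \<inter> L)) (snd ` p)"
    proof (clarsimp simp: pairwise_def)
      fix x K y L assume "(x, K) \<in> p" "(y, L) \<in> p" "K \<noteq> L"
      with pD(5) have "interior K \<inter> interior L = {}" by blast
      moreover obtain a b c d where "K = cbox a b" "L = cbox c d"
        using pD(4) \<open>(x, K) \<in> p\<close> \<open>(y, L) \<in> p\<close> by metis
      ultimately show "negligible (K \<inter> L)"
        by (metis convex_box(1) convex_Int interior_Int negligible_convex_interior)
    qed
  qed
  also have "\<dots> \<le> measure lebesgue U"
  proof (rule measure_mono_fmeasurable)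
    show "\<Union>(snd ` p) \<subseteq> U" using sub by force
    show "\<Union>(snd ` p) \<in> sets lebesgue"
      using pD(1) by (intro sets.finite_Union) (auto dest!: pD(4) intro: fmeasurableD)
  qed (rule U)
  finally show ?thesis .
qed

text \<open>The fundamental theorem of calculus for absolutely continuous functions. In a Riemann sum over a
  sufficiently fine tagged division, the intervals with tag outside \<open>N\<close> are handled by
  differentiability at the tag, as in the classical theorem. Those with tag in \<open>N\<close> are forced by
  the gauge into an open set of small measure containing \<open>N\<close>; their total length is small, and
  absolute continuity is exactly what makes the sum of the increments of \<open>X\<close> over them small.\<close>

lemma absolutely_continuous_has_integral_derivative:
  fixes X :: "real \<Rightarrow> 'v::real_normed_vector"
  assumes ac: "absolutely_continuous_interval s t X" and "s \<le> t" and N: "negligible N"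
    and D: "\<And>r. r \<in> {s..t} - N \<Longrightarrow> (X has_vector_derivative X' r) (at r within {s..t})"
  shows "(X' has_integral (X t - X s)) {s..t}"
proof -
  \<comment> \<open>With the value 0 on \<open>N\<close>, the tags in \<open>N\<close> contribute only increments of \<open>X\<close>.\<close>
  define Y where "Y r = (if r \<in> N then 0 else X' r)" for r
  have "(Y has_integral (X t - X s)) {s..t}"
    unfolding has_integral_real
  proof (intro allI impI)
    fix e :: real assume "0 < e"
    obtain \<delta> where "0 < \<delta>" and \<delta>: "\<And>d. d division_of \<Union>d \<Longrightarrow> \<Union>d \<subseteq> {s..t} \<Longrightarrow>
        (\<Sum>k\<in>d. Sup k - Inf k) < \<delta> \<Longrightarrow> (\<Sum>k\<in>d. norm (X (Sup k) - X (Inf k))) < e/2"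
      using ac[unfolded absolutely_continuous_interval_def, rule_format, OF half_gt_zero[OF \<open>0 < e\<close>]]
      by blast
    have Nl: "N \<in> sets lebesgue" "N \<in> null_sets lebesgue"
      using N by (auto simp: negligible_iff_null_sets)
    obtain U where U: "open U" "N \<subseteq> U" "U - N \<in> lmeasurable" "emeasure lebesgue (U - N) < ennreal \<delta>"
      using sets_lebesgue_outer_open[OF Nl(1) \<open>0 < \<delta>\<close>] by blast
    have Ul: "U \<in> lmeasurable" "measure lebesgue U < \<delta>"
    proof -
      have eq: "U = (U - N) \<union> N" using U by auto
      show "U \<in> lmeasurable"
        by (subst eq) (intro fmeasurable.Un U(3) negligible_imp_measurable N)
      have "emeasure lebesgue U = emeasure lebesgue (U - N)"
        using emeasure_Diff_null_set[OF Nl(2), of U] U(1) by auto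
      then show "measure lebesgue U < \<delta>"
        using U(4) \<open>U \<in> lmeasurable\<close> \<open>0 < \<delta>\<close> by (metis emeasure_eq_measure2 ennreal_less_iff measure_nonneg)
    qed
    define c where "c = e / (2 * (t - s + 1))"
    have "0 < c" using \<open>0 < e\<close> \<open>s \<le> t\<close> by (simp add: c_def)
    have "\<exists>\<rho>>0. \<forall>y\<in>{s..t}. norm (y - r) < \<rho> \<longrightarrow> norm (X y - X r - (y - r) *\<^sub>R X' r) \<le> c * norm (y - r)"
      if "r \<in> {s..t} - N" for r
      using D[OF that] \<open>0 < c\<close> unfolding has_vector_derivative_def has_derivative_within_alt by blast
    then have "\<forall>r\<in>{s..t} - N. \<exists>\<rho>. 0 < \<rho> \<and> (\<forall>y\<in>{s..t}. norm (y - r) < \<rho> \<longrightarrow>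
        norm (X y - X r - (y - r) *\<^sub>R X' r) \<le> c * norm (y - r))"
      by blast
    from bchoice[OF this] obtain \<rho> where \<rho>: "\<And>r. r \<in> {s..t} - N \<Longrightarrow> 0 < \<rho> r"
      "\<And>r y. r \<in> {s..t} - N \<Longrightarrow> y \<in> {s..t} \<Longrightarrow> norm (y - r) < \<rho> r \<Longrightarrow>
         norm (X y - X r - (y - r) *\<^sub>R X' r) \<le> c * norm (y - r)"
      by blast
    define \<gamma> where "\<gamma> r = (if r \<in> N then U else if r \<in> {s..t} then ball r (\<rho> r) else ball r 1)" for r
    have "gauge \<gamma>"
      using U \<rho>(1) by (auto simp: gauge_def \<gamma>_def)
    moreover have "norm ((\<Sum>(x,k)\<in>p. measure lborel k *\<^sub>R Y x) - (X t - X s)) < e"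
      if p: "p tagged_division_of {s..t}" and fine: "\<gamma> fine p" for p
    proof -
      note pD = tagged_division_ofD[OF p]
      have int: "\<exists>a b. K = {a..b} \<and> a \<le> x \<and> x \<le> b \<and> s \<le> a \<and> b \<le> t" if "(x, K) \<in> p" for x K
        using pD(2-4)[OF that] by (auto simp: box_real)
      define E where "E = (\<lambda>(x, K). measure lborel K *\<^sub>R Y x - (X (Sup K) - X (Inf K)))"
      define P where "P = {z\<in>p. fst z \<in> N}"
      define Q where "Q = {z\<in>p. fst z \<notin> N}"
      have fin: "finite P" "finite Q" using pD(1) by (auto simp: P_def Q_def)
      have pp: "p tagged_partial_division_of {s..t}" using p by (simp add: tagged_division_of_def)
      have PP: "P tagged_partial_division_of {s..t}"
        by (rule tagged_partial_division_subset[OF pp]) (auto simp: P_def)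
      have "(\<Sum>(x,k)\<in>p. measure lborel k *\<^sub>R Y x) - (X t - X s)
          = (\<Sum>(x,k)\<in>p. measure lborel k *\<^sub>R Y x) - (\<Sum>(x,k)\<in>p. X (Sup k) - X (Inf k))"
        using additive_tagged_division_1[OF \<open>s \<le> t\<close> p, of X] by simp
      also have "\<dots> = sum E p"
        by (simp add: E_def sum_subtractf case_prod_unfold)
      also have "\<dots> = sum E P + sum E Q"
        using fin by (subst sum.union_disjoint[symmetric]) (auto simp: P_def Q_def intro!: arg_cong[where f="sum E"])
      finally have eq: "(\<Sum>(x,k)\<in>p. measure lborel k *\<^sub>R Y x) - (X t - X s) = sum E P + sum E Q" .
      have "norm (sum E P) \<le> (\<Sum>(x,K)\<in>P. norm (X (Sup K) - X (Inf K)))"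
        by (rule sum_norm_le[THEN order_trans])
           (auto simp: E_def P_def Y_def case_prod_unfold norm_minus_commute intro!: sum_mono)
      \<comment> \<open>Distinct tagged intervals can coincide only if they are degenerate. The summand must then vanish
        on degenerate intervals, including the empty one, where \<open>Sup\<close> and \<open>Inf\<close> are unspecified.\<close>
      also have "\<dots> = (\<Sum>(x,K)\<in>P. if K = {} then 0 else norm (X (Sup K) - X (Inf K)))"
        using int by (intro sum.cong) (fastforce simp: P_def)+
      also have "\<dots> = (\<Sum>K\<in>snd ` P. if K = {} then 0 else norm (X (Sup K) - X (Inf K)))"
      proof (rule sum.over_tagged_division_lemma[OF tagged_partial_division_of_Union_self[OF PP]])
        fix u v :: real assume "box u v = {}"
        then have "v \<le> u" by (simp add: box_real)
        then show "(if cbox u v = {} then 0 else norm (X (Sup (cbox u v)) - X (Inf (cbox u v)))) = 0"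
          by (cases "u = v") (auto simp: box_real)
      qed
      also have "\<dots> \<le> (\<Sum>K\<in>snd ` P. norm (X (Sup K) - X (Inf K)))"
        by (rule sum_mono) auto
      also have "\<dots> < e/2"
      proof (rule \<delta>)
        show "snd ` P division_of \<Union>(snd ` P)"
          by (rule division_of_tagged_division[OF tagged_partial_division_of_Union_self[OF PP]])
        show "\<Union>(snd ` P) \<subseteq> {s..t}" using pD(3) by (force simp: P_def)
        have "(\<Sum>K\<in>snd ` P. Sup K - Inf K) \<le> measure lebesgue U"
        proof (rule sum_lengths_le_measure[OF PP _ Ul(1)])
          fix x K assume "(x, K) \<in> P"
          then show "K \<subseteq> U" using fineD[OF fine, of x K] by (auto simp: P_def \<gamma>_def)
        qed
        with Ul(2) show "(\<Sum>k\<in>snd ` P. Sup k - Inf k) < \<delta>" by simp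
      qed
      finally have 1: "norm (sum E P) < e/2" .
      have "norm (sum E Q) \<le> (\<Sum>(x,K)\<in>Q. c * (Sup K - Inf K))"
      proof (rule sum_norm_le, clarsimp)
        fix x K assume "(x, K) \<in> Q"
        then have xK: "(x, K) \<in> p" "x \<notin> N" by (auto simp: Q_def)
        from int[OF xK(1)] obtain a b where K: "K = {a..b}" "a \<le> x" "x \<le> b" "s \<le> a" "b \<le> t" by blast
        have x: "x \<in> {s..t} - N" using K xK by auto
        have "K \<subseteq> ball x (\<rho> x)" using fineD[OF fine xK(1)] x by (auto simp: \<gamma>_def)
        moreover have "a \<in> K" "b \<in> K" using K by auto
        ultimately have "a \<in> ball x (\<rho> x)" "b \<in> ball x (\<rho> x)" by blast+
        then have ab: "norm (a - x) < \<rho> x" "norm (b - x) < \<rho> x"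
          by (simp_all add: dist_norm norm_minus_commute)
        have "E (x, K) = (X a - X x - (a - x) *\<^sub>R X' x) - (X b - X x - (b - x) *\<^sub>R X' x)"
          using K xK by (simp add: E_def Y_def algebra_simps)
        also have "norm \<dots> \<le> c * norm (a - x) + c * norm (b - x)"
          by (rule norm_triangle_le_diff, rule add_mono; rule \<rho>(2)[OF x]) (use ab K in auto)
        also have "\<dots> = c * (Sup K - Inf K)"
          using K by (simp add: algebra_simps)
        finally show "norm (E (x, K)) \<le> c * (Sup K - Inf K)" .
      qed
      also have "\<dots> \<le> (\<Sum>(x,K)\<in>p. c * (Sup K - Inf K))"
        by (rule sum_mono2[OF pD(1)])
           (use int \<open>0 < c\<close> in \<open>fastforce simp: Q_def\<close>)+
      also have "\<dots> = c * (t - s)"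
        using additive_tagged_division_1[OF \<open>s \<le> t\<close> p, of "\<lambda>x. x"]
        by (simp add: sum_distrib_left[symmetric] case_prod_unfold)
      also have "\<dots> \<le> e/2"
        using \<open>0 < e\<close> \<open>s \<le> t\<close> by (simp add: c_def field_simps)
      finally have 2: "norm (sum E Q) \<le> e/2" .
      show ?thesis unfolding eq using norm_triangle_ineq[of "sum E P" "sum E Q"] 1 2 by linarith
    qed
    ultimately show "\<exists>\<gamma>. gauge \<gamma> \<and> (\<forall>p. p tagged_division_of {s..t} \<and> \<gamma> fine p \<longrightarrow>
         norm ((\<Sum>(x,k)\<in>p. measure lborel k *\<^sub>R Y x) - (X t - X s)) < e)" by (intro exI[of _ \<gamma>]) simp
  qed
  then show ?thesis
    by (rule has_integral_spike[OF N, rotated]) (auto simp: Y_def)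
qed

text \<open>Lebesgue differentiation on the line. If it fails at \<open>t\<close>, then for some \<open>m\<close> there are arbitrarily
  short intervals around \<open>t\<close> whose integral differs from the length times \<open>h t\<close> by at least
  \<open>1 / (m + 1)\<close> times the length. By the Vitali covering theorem, almost all such \<open>t\<close> (for a fixed \<open>m\<close>)
  are covered by countably many disjoint intervals of this kind, which can be taken inside a given
  gauge. Henstock's lemma bounds the sum of these errors, hence the total length of the intervals, by
  an arbitrarily small number.\<close>

lemma indefinite_integral_has_vector_derivative_ae:
  fixes h :: "real \<Rightarrow> 'v::euclidean_space"
  assumes h: "h integrable_on {a..b}"
  obtains N where "negligible N"
    "\<And>t. t \<in> {a<..<b} - N \<Longrightarrow> ((\<lambda>t. integral {a..t} h) has_vector_derivative h t) (at t)"
proof -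
  define wrong where "wrong m t u v \<longleftrightarrow> a \<le> u \<and> u \<le> t \<and> t \<le> v \<and> v \<le> b \<and> u < v \<and>
     (v - u) \<le> real (Suc m) * norm ((v - u) *\<^sub>R h t - integral {u..v} h)" for m t u v
  define bad where "bad m = {t\<in>{a<..<b}. \<forall>d>0. \<exists>u v. wrong m t u v \<and> v - u < d}" for m
  have neg: "negligible (bad m)" for m
    unfolding negligible_outer
  proof (intro allI impI)
    fix e :: real assume "0 < e"
    define e' where "e' = e / (2 * real (Suc m))"
    have "0 < e'" using \<open>0 < e\<close> by (simp add: e'_def)
    obtain \<gamma> where "gauge \<gamma>" and \<gamma>: "\<And>p. \<lbrakk>p tagged_partial_division_of (cbox a b); \<gamma> fine p\<rbrakk> \<Longrightarrow>
             sum (\<lambda>(x,k). norm(measure lborel k *\<^sub>R h x - integral k h)) p < e'"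
      using Henstock_lemma[of h a b e'] h \<open>0 < e'\<close> by (auto simp: box_real)
    define I where "I = {(t, u, v). wrong m t u v \<and> {u..v} \<subseteq> \<gamma> t}"
    define mid where "mid = (\<lambda>(t::real, u::real, v). (u + v) / 2)"
    define rad where "rad = (\<lambda>(t::real, u::real, v). (v - u) / 2)"
    have ball: "cball (mid (t, u, v)) (rad (t, u, v)) = {u..v}" for t u v
      by (simp add: mid_def rad_def cball_eq_atLeastAtMost field_simps)
    obtain C where C: "countable C" "C \<subseteq> I"
      "pairwise (\<lambda>i j. disjnt (cball (mid i) (rad i)) (cball (mid j) (rad j))) C"
      "negligible (bad m - (\<Union>i\<in>C. cball (mid i) (rad i)))"
    proof (rule Vitali_covering_theorem_cballs[of I rad "bad m" mid])
      show "0 < rad i" if "i \<in> I" for i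
        using that by (auto simp: I_def rad_def wrong_def)
      fix t d :: real assume t: "t \<in> bad m" and "0 < d"
      obtain \<eta> where \<eta>: "0 < \<eta>" "ball t \<eta> \<subseteq> \<gamma> t"
        using \<open>gauge \<gamma>\<close> unfolding gauge_def by (meson open_contains_ball)
      obtain u v where uv: "wrong m t u v" "v - u < min d \<eta>"
        using t \<open>0 < d\<close> \<eta>(1) by (auto simp: bad_def dest: spec[of _ "min d \<eta>"])
      have "{u..v} \<subseteq> ball t \<eta>" using uv by (auto simp: wrong_def dist_real_def)
      then have "(t, u, v) \<in> I" using uv \<eta> by (auto simp: I_def)
      moreover have "t \<in> cball (mid (t, u, v)) (rad (t, u, v))" "rad (t, u, v) < d"
        unfolding ball using uv by (auto simp: wrong_def rad_def)
      ultimately show "\<exists>i. i \<in> I \<and> t \<in> cball (mid i) (rad i) \<and> rad i < d" by blast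
    qed blast
    have fin_bound: "measure lebesgue (\<Union>i\<in>J. cball (mid i) (rad i)) \<le> e/2"
      if J: "J \<subseteq> C" "finite J" for J
    proof -
      let ?g = "\<lambda>(t, u, v). (t, {u..v})"
      have wrongJ: "wrong m t u v" "{u..v} \<subseteq> \<gamma> t" if "(t, u, v) \<in> J" for t u v
        using that J C(2) by (auto simp: I_def)
      have dis: "{u..v} \<inter> {u'..v'} = {}"
        if "(t, u, v) \<in> J" "(t', u', v') \<in> J" "(t, u, v) \<noteq> (t', u', v')" for t u v t' u' v'
        using pairwiseD[OF C(3), of "(t, u, v)" "(t', u', v')"] that J unfolding ball disjnt_def by blast
      have inj: "inj_on ?g J"
      proof (rule inj_onI)
        fix i j assume ij: "i \<in> J" "j \<in> J" "?g i = ?g j"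
        obtain t u v t' u' v' where i: "i = (t, u, v)" and j: "j = (t', u', v')"
          by (cases i, cases j)
        have "{u..v} \<noteq> {}" using wrongJ(1)[of t u v] ij i by (auto simp: wrong_def)
        with ij i j dis[of t u v t' u' v'] show "i = j" by auto
      qed
      have part: "?g ` J tagged_partial_division_of cbox a b"
        unfolding tagged_partial_division_of_def
      proof (intro conjI allI impI)
        show "finite (?g ` J)" using J by simp
        fix x K assume "(x, K) \<in> ?g ` J"
        then obtain u v where "K = {u..v}" "(x, u, v) \<in> J" by auto
        then show "x \<in> K" "K \<subseteq> cbox a b" "\<exists>a b. K = cbox a b"
          using wrongJ[of x u v] by (auto simp: wrong_def box_real)
      next
        fix x1 K1 x2 K2 assume *: "(x1, K1) \<in> ?g ` J \<and> (x2, K2) \<in> ?g ` J \<and> (x1, K1) \<noteq> (x2, K2)"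
        then obtain u v u' v' where "K1 = {u..v}" "(x1, u, v) \<in> J" "K2 = {u'..v'}" "(x2, u', v') \<in> J"
          by auto
        with * dis[of x1 u v x2 u' v'] have "K1 \<inter> K2 = {}" by auto
        then show "interior K1 \<inter> interior K2 = {}" using interior_subset by blast
      qed
      have "measure lebesgue (\<Union>i\<in>J. cball (mid i) (rad i)) \<le> (\<Sum>i\<in>J. measure lebesgue (cball (mid i) (rad i)))"
        by (rule measure_UNION_le) (use J in auto)
      also have "\<dots> \<le> (\<Sum>i\<in>J. Suc m * (case ?g i of (x, k) \<Rightarrow> norm (measure lborel k *\<^sub>R h x - integral k h)))"
      proof (rule sum_mono)
        fix i assume "i \<in> J"
        moreover obtain t u v where i: "i = (t, u, v)" by (cases i)
        ultimately have "wrong m t u v" using wrongJ by blast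
        then show "measure lebesgue (cball (mid i) (rad i))
            \<le> Suc m * (case ?g i of (x, k) \<Rightarrow> norm (measure lborel k *\<^sub>R h x - integral k h))"
          unfolding i ball by (simp add: wrong_def)
      qed
      also have "\<dots> = Suc m * (\<Sum>(x, k)\<in>?g ` J. norm (measure lborel k *\<^sub>R h x - integral k h))"
        by (simp add: sum.reindex[OF inj] sum_distrib_left o_def)
      also have "\<dots> \<le> Suc m * e'"
        using \<gamma>[OF part] wrongJ by (intro mult_left_mono less_imp_le) (fastforce simp: fine_def)+
      also have "\<dots> = e/2" by (simp add: e'_def del: of_nat_Suc)
      finally show ?thesis .
    qed
    let ?V = "\<Union>i\<in>C. cball (mid i) (rad i)"
    have V: "?V \<in> lmeasurable" "measure lebesgue ?V \<le> e/2"
      using fmeasurable_UN_bound[OF C(1) _ fin_bound] measure_UN_bound[OF C(1) _ fin_bound] by auto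
    have W: "bad m - ?V \<in> lmeasurable" "measure lebesgue (bad m - ?V) = 0"
      using C(4) negligible_imp_measurable negligible_imp_measure0 by blast+
    show "\<exists>T. bad m \<subseteq> T \<and> T \<in> lmeasurable \<and> measure lebesgue T < e"
    proof (intro exI conjI)
      show "bad m \<subseteq> ?V \<union> (bad m - ?V)" by auto
      show "?V \<union> (bad m - ?V) \<in> lmeasurable" using V W by (intro fmeasurable.Un)
      have "measure lebesgue (?V \<union> (bad m - ?V)) \<le> e/2 + 0"
        using measure_Un_le[of ?V lebesgue "bad m - ?V"] V W by (auto dest: fmeasurableD)
      then show "measure lebesgue (?V \<union> (bad m - ?V)) < e" using \<open>0 < e\<close> by simp
    qed
  qed
  show ?thesis
  proof
    show "negligible (\<Union>m. bad m)" using neg by (intro negligible_countable_Union) auto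
    fix t assume t: "t \<in> {a<..<b} - (\<Union>m. bad m)"
    show "((\<lambda>t. integral {a..t} h) has_vector_derivative h t) (at t)"
      unfolding has_vector_derivative_def has_derivative_at_alt
    proof (intro conjI allI impI)
      show "bounded_linear (\<lambda>r. r *\<^sub>R h t)" by (rule bounded_linear_scaleR_left)
      fix e :: real assume "0 < e"
      then obtain m where m: "inverse (Suc m) < e" using reals_Archimedean by blast
      have "t \<notin> bad m" using t by blast
      with t have "\<exists>d>0. \<forall>u v. wrong m t u v \<longrightarrow> \<not> v - u < d"
        unfolding bad_def by simp
      then obtain d where "0 < d" and d: "\<And>u v. wrong m t u v \<Longrightarrow> \<not> v - u < d"
        by blast
      have key: "norm ((v - u) *\<^sub>R h t - integral {u..v} h) \<le> e * (v - u)"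
        if "a \<le> u" "u \<le> t" "t \<le> v" "v \<le> b" "v - u < d" for u v
      proof (cases "u < v")
        case True
        with d[of u v] that have "Suc m * norm ((v - u) *\<^sub>R h t - integral {u..v} h) < v - u"
          by (force simp: wrong_def)
        then have "norm ((v - u) *\<^sub>R h t - integral {u..v} h) \<le> inverse (Suc m) * (v - u)"
          by (simp add: field_simps)
        also have "\<dots> \<le> e * (v - u)" using m True by (intro mult_right_mono) auto
        finally show ?thesis .
      next
        case False
        with that have "u = t" "v = t" by auto
        then show ?thesis by simp
      qed
      show "\<exists>d>0. \<forall>y. norm (y - t) < d \<longrightarrow>
          norm (integral {a..y} h - integral {a..t} h - (y - t) *\<^sub>R h t) \<le> e * norm (y - t)"
      proof (intro exI[of _ "min d (min (t - a) (b - t))"] conjI allI impI)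
        show "0 < min d (min (t - a) (b - t))" using \<open>0 < d\<close> t by auto
        fix y assume y: "norm (y - t) < min d (min (t - a) (b - t))"
        then have ab: "a \<le> y" "y \<le> b" by (auto simp: abs_less_iff)
        have sub: "h integrable_on {a..r}" if "r \<le> b" for r
          using h by (rule integrable_on_subinterval) (use that in auto)
        show "norm (integral {a..y} h - integral {a..t} h - (y - t) *\<^sub>R h t) \<le> e * norm (y - t)"
        proof (cases "t \<le> y")
          case True
          have "integral {a..t} h + integral {t..y} h = integral {a..y} h"
            using Henstock_Kurzweil_Integration.integral_combine[OF _ True sub[OF ab(2)]] t by auto
          then have "integral {a..y} h - integral {a..t} h - (y - t) *\<^sub>R h t
             = - ((y - t) *\<^sub>R h t - integral {t..y} h)" by (simp add: algebra_simps)
          then show ?thesis using key[of t y] True t ab y by (simp only: norm_minus_cancel) auto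
        next
          case False
          then have "integral {a..y} h + integral {y..t} h = integral {a..t} h"
            using Henstock_Kurzweil_Integration.integral_combine[OF ab(1) _ sub, of t] t by auto
          then have "integral {a..y} h - integral {a..t} h - (y - t) *\<^sub>R h t
             = (t - y) *\<^sub>R h t - integral {y..t} h" by (simp add: algebra_simps)
          then show ?thesis using key[of y t] False t ab y by auto
        qed
      qed
    qed
  qed
qed

section \<open>Caratheodory solutions of differential equations\<close>

lemma indefinite_integral_lipschitz:
  fixes g :: "real \<Rightarrow> 'v::euclidean_space"
  assumes int: "\<And>t. 0 \<le> t \<Longrightarrow> g integrable_on {0..t}"
    and bound: "\<And>t. 0 \<le> t \<Longrightarrow> norm (g t) \<le> K"
  shows "K-lipschitz_on {0..} (\<lambda>t. integral {0..t} g)"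
proof (rule lipschitz_on_leI)
  show "0 \<le> K" using bound[of 0] norm_ge_zero[of "g 0"] by linarith
  fix s t :: real assume "s \<in> {0..}" "t \<in> {0..}" "s \<le> t"
  then have st: "0 \<le> s" "s \<le> t" "0 \<le> t" by auto
  have "integral {0..s} g + integral {s..t} g = integral {0..t} g"
    by (rule Henstock_Kurzweil_Integration.integral_combine[OF st(1,2) int[OF st(3)]])
  then have "dist (integral {0..s} g) (integral {0..t} g) = norm (integral {s..t} g)"
    by (metis add_diff_cancel_left' dist_commute dist_norm)
  also have "\<dots> \<le> K * (t - s)"
  proof -
    have "g integrable_on {s..t}"
      using int[OF st(3)] by (rule integrable_on_subinterval) (use st in auto)
    then have "norm (integral {s..t} g) \<le> integral {s..t} (\<lambda>_. K)"
      by (rule Henstock_Kurzweil_Integration.integral_norm_bound_integral) (use st bound in auto)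
    then show ?thesis using st by (simp add: mult.commute)
  qed
  finally show "dist (integral {0..s} g) (integral {0..t} g) \<le> K * dist s t"
    using st by (simp add: dist_real_def)
qed

text \<open>Existence and uniqueness for all times at once, by Banach's fixed point theorem in a space of
  functions with an exponentially weighted sup norm. The field \<open>\<phi>\<close> may be merely measurable in time,
  so only the integrated equation makes sense at every time. Since \<open>\<phi>\<close> is bounded, every solution grows at
  most linearly and therefore lies in that space, which makes the uniqueness unconditional.\<close>

lemma integral_equation_unique_solution:
  fixes \<phi> :: "real \<Rightarrow> 'v::euclidean_space \<Rightarrow> 'v"
  assumes int: "\<And>X t. continuous_on {0..} X \<Longrightarrow> 0 \<le> t \<Longrightarrow> (\<lambda>s. \<phi> s (X s)) integrable_on {0..t}"
    and lip: "\<And>s x y. 0 \<le> s \<Longrightarrow> norm (\<phi> s x - \<phi> s y) \<le> L * norm (x - y)" and "0 \<le> L"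
    and bound: "\<And>s x. 0 \<le> s \<Longrightarrow> norm (\<phi> s x) \<le> K"
  shows "\<exists>!X. X \<in> extensional {0..} \<and> continuous_on {0..} X \<and>
           (\<forall>t\<ge>0. X t = x + integral {0..t} (\<lambda>s. \<phi> s (X s)))"
proof -
  define c where "c = 2 * L + 1"
  have c: "1 \<le> c" "0 < c" "L / c \<le> 1/2" using \<open>0 \<le> L\<close> by (auto simp: c_def field_simps)
  have "0 \<le> K" using order_trans[OF norm_ge_zero bound[of 0]] by simp
  have weight: "norm (exp (- c * r) *\<^sub>R v) \<le> K" if "0 \<le> r" "norm v \<le> K * r" for r :: real and v :: 'v
  proof -
    have "r \<le> exp (c * r)"
      using exp_ge_add_one_self[of "c * r"] mult_right_mono[OF c(1) \<open>0 \<le> r\<close>] by linarith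
    then have "norm v \<le> K * exp (c * r)"
      using that(2) \<open>0 \<le> K\<close> by (meson mult_left_mono order_trans)
    then have "exp (- c * r) * norm v \<le> K"
      by (simp add: exp_minus pos_divide_le_eq inverse_eq_divide)
    then show ?thesis by simp
  qed
  \<comment> \<open>Candidate solutions are written as \<open>x + exp (c * t) * Y t\<close> with \<open>Y\<close> bounded and continuous;
    in the sup norm of \<open>Y\<close> the integral operator contracts with factor \<open>L / c\<close>, and \<open>c \<ge> 1\<close> makes
    the weight absorb linear growth. Negative times are collapsed to 0 by \<open>max 0 t\<close>, so that the operator
    acts on functions on the whole line.\<close>
  define lft where "lft Y s = x + exp (c * s) *\<^sub>R apply_bcontfun Y s" for Y :: "real \<Rightarrow>\<^sub>C 'v" and s
  define J where "J Y t = integral {0..t} (\<lambda>s. \<phi> s (lft Y s))" for Y t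
  define \<Psi> where "\<Psi> Y = Bcontfun (\<lambda>t. exp (- c * max 0 t) *\<^sub>R J Y (max 0 t))" for Y
  have lft_int: "(\<lambda>s. \<phi> s (lft Y s)) integrable_on {0..t}" if "0 \<le> t" for Y t
    by (rule int[OF _ that]) (auto simp: lft_def intro!: continuous_intros)
  have J0: "J Y 0 = 0" for Y by (simp add: J_def)
  have Jlip: "K-lipschitz_on {0..} (J Y)" for Y
    unfolding J_def by (rule indefinite_integral_lipschitz) (auto intro: lft_int bound)
  have \<Psi>: "apply_bcontfun (\<Psi> Y) t = exp (- c * max 0 t) *\<^sub>R J Y (max 0 t)" for Y t
  proof -
    have "continuous_on {0..} (J Y)" by (rule lipschitz_on_continuous_on[OF Jlip])
    then have "continuous_on UNIV (\<lambda>t. J Y (max 0 t))"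
      by (rule continuous_on_compose2) (auto intro!: continuous_intros)
    then have "continuous_on UNIV (\<lambda>t. exp (- c * max 0 t) *\<^sub>R J Y (max 0 t))"
      by (intro continuous_intros)
    moreover have "norm (exp (- c * max 0 t) *\<^sub>R J Y (max 0 t)) \<le> K" for t
      using lipschitz_onD[OF Jlip, of "max 0 t" 0 Y] by (intro weight) (simp_all add: J0)
    ultimately have "(\<lambda>t. exp (- c * max 0 t) *\<^sub>R J Y (max 0 t)) \<in> bcontfun"
      by (auto simp: bcontfun_def intro!: boundedI)
    then show ?thesis by (simp add: \<Psi>_def Bcontfun_inverse)
  qed
  have contr: "dist (\<Psi> Y) (\<Psi> Z) \<le> 1/2 * dist Y Z" for Y Z
  proof (rule dist_bound)
    fix t :: real
    define r where "r = max 0 t"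
    have "0 \<le> r" by (simp add: r_def)
    define d where "d = dist Y Z"
    have hi: "((\<lambda>s. L * d * exp (c * s)) has_integral
        (L * d * exp (c * r) / c - L * d * exp (c * 0) / c)) {0..r}"
      by (rule fundamental_theorem_of_calculus[OF \<open>0 \<le> r\<close>])
         (use c in \<open>auto intro!: derivative_eq_intros simp: has_real_derivative_iff_has_vector_derivative[symmetric]\<close>)
    have "norm (J Y r - J Z r) = norm (integral {0..r} (\<lambda>s. \<phi> s (lft Y s) - \<phi> s (lft Z s)))"
      unfolding J_def by (simp add: integral_diff lft_int \<open>0 \<le> r\<close>)
    also have "\<dots> \<le> integral {0..r} (\<lambda>s. L * d * exp (c * s))"
    proof (rule integral_norm_bound_integral)
      show "(\<lambda>s. L * d * exp (c * s)) integrable_on {0..r}" using hi by blast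
      fix s assume "s \<in> {0..r}"
      then have "norm (\<phi> s (lft Y s) - \<phi> s (lft Z s)) \<le> L * norm (lft Y s - lft Z s)"
        by (intro lip) auto
      also have "lft Y s - lft Z s = exp (c * s) *\<^sub>R (apply_bcontfun Y s - apply_bcontfun Z s)"
        by (simp add: lft_def algebra_simps)
      also have "norm \<dots> = exp (c * s) * dist (apply_bcontfun Y s) (apply_bcontfun Z s)"
        by (simp add: dist_norm)
      also have "L * \<dots> \<le> L * (exp (c * s) * d)"
        unfolding d_def by (intro mult_left_mono dist_bounded \<open>0 \<le> L\<close>) auto
      finally show "norm (\<phi> s (lft Y s) - \<phi> s (lft Z s)) \<le> L * d * exp (c * s)"
        by (simp add: algebra_simps)
    qed (intro integrable_diff lft_int \<open>0 \<le> r\<close>)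
    also have "\<dots> = L * d * exp (c * r) / c - L * d / c"
      using integral_unique[OF hi] by simp
    also have "\<dots> \<le> (L / c) * (d * exp (c * r))"
    proof -
      have "0 \<le> L * d / c" using c \<open>0 \<le> L\<close> by (simp add: d_def)
      then show ?thesis by simp
    qed
    also have "\<dots> \<le> 1/2 * (d * exp (c * r))"
      by (intro mult_right_mono c) (auto simp: d_def)
    finally have "norm (J Y r - J Z r) \<le> 1/2 * d * exp (c * r)" by simp
    then have "exp (- c * r) * norm (J Y r - J Z r) \<le> 1/2 * d"
      by (simp add: exp_minus field_simps)
    then show "dist (apply_bcontfun (\<Psi> Y) t) (apply_bcontfun (\<Psi> Z) t) \<le> 1/2 * dist Y Z"
      by (simp add: \<Psi> dist_norm d_def r_def[symmetric] flip: scaleR_diff_right)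
  qed
  have "\<exists>!Y. \<Psi> Y = Y"
    by (rule banach_fix_type[of "1/2"]) (use contr in auto)
  then obtain Y0 where Y0: "\<Psi> Y0 = Y0" and uniq: "\<And>Y. \<Psi> Y = Y \<Longrightarrow> Y = Y0" by blast
  let ?sol = "\<lambda>X. X \<in> extensional {0..} \<and> continuous_on {0..} X \<and>
           (\<forall>t\<ge>0. X t = x + integral {0..t} (\<lambda>s. \<phi> s (X s)))"
  define X0 where "X0 = restrict (lft Y0) {0..}"
  show ?thesis
  proof (rule ex1I[of ?sol X0])
    have J_lft: "lft Y0 t = x + J Y0 t" if "0 \<le> t" for t
      using \<Psi>[of Y0 t] that unfolding Y0 by (simp add: lft_def exp_minus)
    have "continuous_on {0..} X0 \<longleftrightarrow> continuous_on {0..} (lft Y0)"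
      by (rule continuous_on_cong) (auto simp: X0_def)
    moreover have "continuous_on {0..} (lft Y0)"
      by (auto simp: lft_def intro!: continuous_intros)
    moreover have "X0 t = x + integral {0..t} (\<lambda>s. \<phi> s (X0 s))" if "0 \<le> t" for t
    proof -
      have "integral {0..t} (\<lambda>s. \<phi> s (X0 s)) = J Y0 t"
        unfolding J_def by (rule Henstock_Kurzweil_Integration.integral_cong) (auto simp: X0_def)
      with J_lft[OF that] that show ?thesis by (simp add: X0_def)
    qed
    ultimately show "?sol X0" by (simp add: X0_def)
  next
    fix X assume X: "?sol X"
    let ?Y = "\<lambda>t. exp (- c * max 0 t) *\<^sub>R (X (max 0 t) - x)"
    have XJ: "X t - x = integral {0..t} (\<lambda>s. \<phi> s (X s))" if "0 \<le> t" for t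
    proof -
      from X that have "X t = x + integral {0..t} (\<lambda>s. \<phi> s (X s))" by blast
      then show ?thesis by (metis add_diff_cancel_left')
    qed
    have lipX: "K-lipschitz_on {0..} (\<lambda>t. integral {0..t} (\<lambda>s. \<phi> s (X s)))"
      by (rule indefinite_integral_lipschitz) (use X in \<open>auto intro: int bound\<close>)
    have "continuous_on UNIV (\<lambda>t. X (max 0 t))"
      by (rule continuous_on_compose2[of "{0..}" X]) (use X in \<open>auto intro!: continuous_intros\<close>)
    then have "continuous_on UNIV ?Y" by (intro continuous_intros)
    moreover have "norm (?Y t) \<le> K" for t
      using lipschitz_onD[OF lipX, of "max 0 t" 0] by (intro weight) (simp_all add: XJ)
    ultimately have "?Y \<in> bcontfun"
      by (auto simp: bcontfun_def intro!: boundedI)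
    then obtain Y where Y: "?Y = apply_bcontfun Y" by (rule bcontfunE)
    have lftY: "lft Y t = X t" if "0 \<le> t" for t
      using that by (simp add: lft_def Y[symmetric] exp_minus)
    have "J Y t = X t - x" if "0 \<le> t" for t
      unfolding XJ[OF that] J_def
      by (rule Henstock_Kurzweil_Integration.integral_cong) (simp add: lftY)
    then have "\<Psi> Y = Y"
      by (intro bcontfun_eqI) (simp add: \<Psi> flip: Y)
    then have "Y = Y0" by (rule uniq)
    show "X = X0"
    proof (rule extensionalityI[of _ "{0..}"])
      show "X t = X0 t" if "t \<in> {0..}" for t
        using lftY[of t] that \<open>Y = Y0\<close> by (simp add: X0_def)
    qed (use X in \<open>auto simp: X0_def\<close>)
  qed
qed

lemma lipschitz_imp_absolutely_continuous:
  fixes X :: "real \<Rightarrow> 'v::real_normed_vector"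
  assumes lip: "K-lipschitz_on {s..t} X"
  shows "absolutely_continuous_interval s t X"
  unfolding absolutely_continuous_interval_def
proof (intro allI impI)
  fix e :: real assume "0 < e"
  have "0 \<le> K" using lip by (rule lipschitz_on_nonneg)
  show "\<exists>\<delta>>0. \<forall>d. d division_of \<Union>d \<and> \<Union>d \<subseteq> {s..t} \<and> (\<Sum>k\<in>d. Sup k - Inf k) < \<delta> \<longrightarrow>
        (\<Sum>k\<in>d. norm (X (Sup k) - X (Inf k))) < e"
  proof (intro exI[of _ "e / (K + 1)"] conjI allI impI)
    show "0 < e / (K + 1)" using \<open>0 < e\<close> \<open>0 \<le> K\<close> by simp
    fix d assume d: "d division_of \<Union>d \<and> \<Union>d \<subseteq> {s..t} \<and> (\<Sum>k\<in>d. Sup k - Inf k) < e / (K + 1)"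
    have k: "norm (X (Sup k) - X (Inf k)) \<le> K * (Sup k - Inf k) \<and> Inf k \<le> Sup k" if "k \<in> d" for k
    proof -
      have dk: "k \<noteq> {}" "k \<subseteq> {s..t}" "\<exists>a b. k = cbox a b"
        using d division_ofD(3,4)[of d _ k] that by blast+
      then obtain a b where ab: "k = {a..b}" "a \<le> b" by (auto simp: box_real)
      then show ?thesis
        using lipschitz_onD[OF lip, of b a] dk(2) by (auto simp: dist_norm)
    qed
    have nn: "0 \<le> (\<Sum>k\<in>d. Sup k - Inf k)" using k by (intro sum_nonneg) auto
    have "(\<Sum>k\<in>d. norm (X (Sup k) - X (Inf k))) \<le> (\<Sum>k\<in>d. K * (Sup k - Inf k))"
      using k by (intro sum_mono) blast
    also have "\<dots> = K * (\<Sum>k\<in>d. Sup k - Inf k)" by (simp add: sum_distrib_left)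
    also have "\<dots> \<le> (K + 1) * (\<Sum>k\<in>d. Sup k - Inf k)" using nn by (simp add: distrib_right)
    also have "\<dots> < (K + 1) * (e / (K + 1))" using d \<open>0 \<le> K\<close> by (intro mult_strict_left_mono) auto
    also have "\<dots> = e" using \<open>0 \<le> K\<close> by simp
    finally show "(\<Sum>k\<in>d. norm (X (Sup k) - X (Inf k))) < e" .
  qed
qed

lemma absolutely_continuous_imp_continuous_on:
  fixes X :: "real \<Rightarrow> 'v::real_normed_vector"
  assumes ac: "absolutely_continuous_interval s t X"
  shows "continuous_on {s..t} X"
  unfolding continuous_on_iff
proof (intro ballI allI impI)
  fix r e :: real assume r: "r \<in> {s..t}" and "0 < e"
  obtain \<delta> where "0 < \<delta>" and \<delta>: "\<And>d. d division_of \<Union>d \<Longrightarrow> \<Union>d \<subseteq> {s..t} \<Longrightarrow>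
      (\<Sum>k\<in>d. Sup k - Inf k) < \<delta> \<Longrightarrow> (\<Sum>k\<in>d. norm (X (Sup k) - X (Inf k))) < e"
    using ac[unfolded absolutely_continuous_interval_def, rule_format, OF \<open>0 < e\<close>] by blast
  have *: "norm (X v - X u) < e" if "u \<in> {s..t}" "v \<in> {s..t}" "u \<le> v" "v - u < \<delta>" for u v
  proof -
    have "{{u..v}} division_of \<Union>{{u..v}}"
      using division_of_self[of u v] that by (simp add: box_real)
    from \<delta>[OF this] that show ?thesis by auto
  qed
  show "\<exists>d>0. \<forall>r'\<in>{s..t}. dist r' r < d \<longrightarrow> dist (X r') (X r) < e"
  proof (intro exI[of _ \<delta>] conjI ballI impI \<open>0 < \<delta>\<close>)
    fix r' assume r': "r' \<in> {s..t}" "dist r' r < \<delta>"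
    show "dist (X r') (X r) < e"
      using *[of r r'] *[of r' r] r r' by (cases "r \<le> r'") (auto simp: dist_norm norm_minus_commute)
  qed
qed

text \<open>The differential equation almost everywhere, for absolutely continuous functions, is the same as
  the integral equation for continuous functions: one direction is the fundamental theorem of calculus,
  the other is Lebesgue differentiation.\<close>

lemma is_trajectory_iff_integral_equation:
  fixes f :: "real ^ 'n \<Rightarrow> 'a \<Rightarrow> 'b \<Rightarrow> real ^ 'n"
  assumes int: "\<And>X t. continuous_on {0..} X \<Longrightarrow> 0 \<le> t \<Longrightarrow>
      (\<lambda>s. f (X s) (a s) (b s)) integrable_on {0..t}"
    and bound: "\<And>s y. 0 \<le> s \<Longrightarrow> norm (f y (a s) (b s)) \<le> K"
  shows "is_trajectory f x a b X \<longleftrightarrow> X \<in> extensional {0..} \<and> continuous_on {0..} X \<and>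
           (\<forall>t\<ge>0. X t = x + integral {0..t} (\<lambda>s. f (X s) (a s) (b s)))" (is "_ \<longleftrightarrow> ?R")
proof
  assume X: "is_trajectory f x a b X"
  then have ac: "absolutely_continuous_interval 0 T X" if "0 \<le> T" for T
    using that by (simp add: is_trajectory_def)
  obtain N where N: "negligible N" "{t. \<not> (t > 0 \<longrightarrow> (X has_vector_derivative f (X t) (a t) (b t)) (at t))} \<subseteq> N"
    using X unfolding is_trajectory_def eventually_ae_filter_negligible by blast
  have "continuous_on {0..} X"
    unfolding continuous_on_iff
  proof (intro ballI allI impI)
    fix t e :: real assume "t \<in> {0..}" "0 < e"
    then have "continuous_on {0..t + 1} X"
      by (intro absolutely_continuous_imp_continuous_on ac) auto
    then obtain d where "0 < d" and d: "\<And>t'. t' \<in> {0..t + 1} \<Longrightarrow> dist t' t < d \<Longrightarrow> dist (X t') (X t) < e"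
      using \<open>t \<in> {0..}\<close> \<open>0 < e\<close> unfolding continuous_on_iff by force
    show "\<exists>d>0. \<forall>t'\<in>{0..}. dist t' t < d \<longrightarrow> dist (X t') (X t) < e"
      by (intro exI[of _ "min d 1"]) (use \<open>0 < d\<close> in \<open>auto intro!: d simp: dist_real_def\<close>)
  qed
  moreover have "X t = x + integral {0..t} (\<lambda>s. f (X s) (a s) (b s))" if "0 \<le> t" for t
  proof -
    have "((\<lambda>s. f (X s) (a s) (b s)) has_integral X t - X 0) {0..t}"
    proof (rule absolutely_continuous_has_integral_derivative[OF ac[OF that] that])
      \<comment> \<open>The equation is required only at positive times.\<close>
      show "negligible (insert 0 N)" using N(1) by simp
      fix r assume "r \<in> {0..t} - insert 0 N"
      then have "0 < r" "r \<notin> N" by auto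
      with N(2) have "(X has_vector_derivative f (X r) (a r) (b r)) (at r)" by blast
      then show "(X has_vector_derivative f (X r) (a r) (b r)) (at r within {0..t})"
        by (rule has_vector_derivative_at_within)
    qed
    from integral_unique[OF this] X show ?thesis by (simp add: is_trajectory_def)
  qed
  ultimately show ?R using X by (simp add: is_trajectory_def)
next
  assume R: ?R
  define h where "h s = f (X s) (a s) (b s)" for s
  have hint: "h integrable_on {0..t}" if "0 \<le> t" for t
    unfolding h_def using R that by (intro int) auto
  have Xh: "X t = x + integral {0..t} h" if "0 \<le> t" for t
    using R that by (simp add: h_def[abs_def])
  have "K-lipschitz_on {0..} (\<lambda>t. integral {0..t} h)"
    by (rule indefinite_integral_lipschitz) (auto intro: hint bound simp: h_def)
  then have lip: "K-lipschitz_on {0..} X"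
    by (simp add: lipschitz_on_def Xh)
  have "\<exists>N. negligible N \<and>
      (\<forall>t\<in>{0<..<real n} - N. ((\<lambda>t. integral {0..t} h) has_vector_derivative h t) (at t))" for n
    by (rule indefinite_integral_has_vector_derivative_ae[OF hint[of "real n"]]) auto
  then obtain N where N: "\<And>n. negligible (N n)"
    "\<And>n t. t \<in> {0<..<real n} - N n \<Longrightarrow> ((\<lambda>t. integral {0..t} h) has_vector_derivative h t) (at t)"
    by metis
  have "AE t in lebesgue. t > 0 \<longrightarrow> (X has_vector_derivative f (X t) (a t) (b t)) (at t)"
    unfolding eventually_ae_filter_negligible
  proof (intro exI conjI)
    show "negligible (\<Union>n. N n)" using N(1) by (intro negligible_countable_Union) auto
    have "(X has_vector_derivative f (X t) (a t) (b t)) (at t)" if t: "t > 0" "t \<notin> (\<Union>n. N n)" for t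
    proof -
      obtain n where "t < real n" using reals_Archimedean2 by blast
      with N(2)[of t n] t have "((\<lambda>t. integral {0..t} h) has_vector_derivative h t) (at t)" by auto
      then have "((\<lambda>t. x + integral {0..t} h) has_vector_derivative h t) (at t)"
        by (auto intro!: derivative_eq_intros)
      then show ?thesis
        unfolding h_def[of t, symmetric]
        by (rule has_vector_derivative_transform_within_open[of _ _ _ "{0<..}"]) (use t Xh in auto)
    qed
    then show "{t. \<not> (t > 0 \<longrightarrow> (X has_vector_derivative f (X t) (a t) (b t)) (at t))} \<subseteq> (\<Union>n. N n)"
      by blast
  qed
  moreover have "absolutely_continuous_interval 0 T X" for T
    by (rule lipschitz_imp_absolutely_continuous[OF lipschitz_on_subset[OF lip]]) auto
  ultimately show "is_trajectory f x a b X"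
    using R Xh[of 0] by (simp add: is_trajectory_def)
qed

section \<open>Periodic sets and functions\<close>

lemma lattice_cell:
  fixes x :: "real ^ 'n"
  obtains k where "k \<in> int_lattice" "x - k \<in> cbox 0 1"
proof
  show "(\<chi> i. of_int \<lfloor>x $ i\<rfloor>) \<in> (int_lattice :: (real ^ 'n) set)"
    by (simp add: int_lattice_def)
  show "x - (\<chi> i. of_int \<lfloor>x $ i\<rfloor>) \<in> cbox 0 1"
    unfolding mem_box_cart by (auto simp: algebra_simps) linarith
qed

lemma minus_int_lattice: "k \<in> int_lattice \<Longrightarrow> - k \<in> int_lattice"
  by (auto simp: int_lattice_def)

lemma closed_vimage_torus_proj:
  assumes "closed S"
  shows "closed (torus_proj -` S)"
  using assms by (metis closed_def open_torus_def vimage_Compl)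

lemma torus_proj_add_lattice: "k \<in> int_lattice \<Longrightarrow> torus_proj (x + k) = torus_proj x"
  by (simp add: torus_proj_eq_iff)

lemma periodic_infdist:
  assumes E: "\<And>x k. x \<in> E \<Longrightarrow> k \<in> int_lattice \<Longrightarrow> x + k \<in> E" and k: "k \<in> int_lattice"
  shows "infdist (x + k) E = infdist x E"
proof -
  have eq: "E = (\<lambda>y. y + k) ` E"
  proof
    show "E \<subseteq> (\<lambda>y. y + k) ` E"
    proof
      fix y assume "y \<in> E"
      then have "y + - k \<in> E" by (intro E minus_int_lattice k)
      then show "y \<in> (\<lambda>y. y + k) ` E" by (intro image_eqI[of _ _ "y + - k"]) auto
    qed
  qed (use E k in auto)
  have "(INF y\<in>E. dist (x + k) y) = (INF y\<in>E. dist (x + k) (y + k))"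
    by (subst eq) (simp add: image_image)
  then show ?thesis by (simp add: infdist_def)
qed

text \<open>Closed sets have a positive distance when one of them is compact. Periodicity reduces the first
  set to its part in the unit cube.\<close>

lemma periodic_separation:
  fixes E F :: "(real ^ 'n) set"
  assumes E: "closed E" "\<And>x k. x \<in> E \<Longrightarrow> k \<in> int_lattice \<Longrightarrow> x + k \<in> E"
    and F: "closed F" "\<And>x k. x \<in> F \<Longrightarrow> k \<in> int_lattice \<Longrightarrow> x + k \<in> F"
    and "E \<inter> F = {}"
  obtains d where "0 < d" "\<And>x y. x \<in> E \<Longrightarrow> y \<in> F \<Longrightarrow> d \<le> dist x y"
proof -
  have "compact (E \<inter> cbox 0 1)" using E(1) by (simp add: closed_Int_compact)
  moreover have "E \<inter> cbox 0 1 \<inter> F = {}" using \<open>E \<inter> F = {}\<close> by auto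
  ultimately obtain d where d: "0 < d" "\<And>x y. x \<in> E \<inter> cbox 0 1 \<Longrightarrow> y \<in> F \<Longrightarrow> d \<le> dist x y"
    using separate_compact_closed[OF _ F(1), of "E \<inter> cbox 0 1"] by metis
  show ?thesis
  proof
    fix x y assume "x \<in> E" "y \<in> F"
    obtain k where k: "k \<in> int_lattice" "x - k \<in> cbox 0 1" by (rule lattice_cell)
    have "d \<le> dist (x + - k) (y + - k)"
      using E(2)[OF \<open>x \<in> E\<close> minus_int_lattice[OF k(1)]] F(2)[OF \<open>y \<in> F\<close> minus_int_lattice[OF k(1)]] k(2)
      by (intro d(2)) auto
    then show "d \<le> dist x y" by (simp add: dist_norm)
  qed (rule d(1))
qed

text \<open>Urysohn's lemma on the torus, with constant values on whole neighbourhoods of the two sets. Dominions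
  keep trajectories only near themselves, so values on the sets alone would not be enough.\<close>

lemma periodic_Urysohn:
  fixes E F :: "(real ^ 'n) set"
  assumes E: "closed E" "\<And>x k. x \<in> E \<Longrightarrow> k \<in> int_lattice \<Longrightarrow> x + k \<in> E" "E \<noteq> {}"
    and F: "closed F" "\<And>x k. x \<in> F \<Longrightarrow> k \<in> int_lattice \<Longrightarrow> x + k \<in> F" "F \<noteq> {}"
    and "E \<inter> F = {}"
  obtains g :: "real ^ 'n \<Rightarrow> real" and \<epsilon> where "continuous_on UNIV g" "lattice_periodic g"
    "\<And>x. 0 \<le> g x \<and> g x \<le> 1" "0 < \<epsilon>"
    "\<And>x. infdist x E \<le> \<epsilon> \<Longrightarrow> g x = 0" "\<And>x. infdist x F \<le> \<epsilon> \<Longrightarrow> g x = 1"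
proof -
  obtain d where d: "0 < d" "\<And>x y. x \<in> E \<Longrightarrow> y \<in> F \<Longrightarrow> d \<le> dist x y"
    using periodic_separation[OF E(1,2) F(1,2) \<open>E \<inter> F = {}\<close>] by blast
  \<comment> \<open>Zero up to distance \<open>d / 3\<close> from \<open>E\<close> and one from distance \<open>2 * d / 3\<close> on; the triangle
    inequality puts the \<open>d / 3\<close>-neighbourhood of \<open>F\<close> in the second region.\<close>
  define g where "g x = max 0 (min 1 (3 * infdist x E / d - 1))" for x
  show ?thesis
  proof (rule that[of g "d/3"])
    show "continuous_on UNIV g"
      unfolding g_def using \<open>0 < d\<close> by (intro continuous_intros) auto
    show "lattice_periodic g"
      using periodic_infdist[OF E(2)] by (simp add: lattice_periodic_def g_def)
    show "g x = 0" if "infdist x E \<le> d/3" for x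
      using that \<open>0 < d\<close> by (simp add: g_def field_simps)
    show "g x = 1" if x: "infdist x F \<le> d/3" for x
    proof -
      obtain y where y: "y \<in> F" "infdist x F = dist x y"
        using infdist_attains_inf[OF F(1,3)] by blast
      obtain e where e: "e \<in> E" "infdist y E = dist y e"
        using infdist_attains_inf[OF E(1,3)] by blast
      have "d \<le> infdist y E" using d(2)[OF e(1) y(1)] e(2) by (simp add: dist_commute)
      also have "\<dots> \<le> infdist x E + dist y x" by (rule infdist_triangle)
      finally have "2 * d \<le> 3 * infdist x E" using x y(2) by (simp add: dist_commute)
      then show ?thesis using \<open>0 < d\<close> by (simp add: g_def field_simps)
    qed
  qed (use \<open>0 < d\<close> in \<open>auto simp: g_def\<close>)
qed

section \<open>Measurability along controls and trajectories\<close>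

text \<open>The Borel \<open>\<sigma>\<close>-algebra of a product of metric spaces may be larger than the product of the Borel
  \<open>\<sigma>\<close>-algebras, so that pairs of measurable functions need an argument here. It is enough that the first
  component takes values near a countable set \<open>Q\<close>: an open set of pairs is then, on the values taken, a
  countable union of open rectangles whose first sides are balls centred in \<open>Q\<close>.\<close>

lemma borel_measurable_Pair_separable:
  fixes u :: "'m \<Rightarrow> 'c::metric_space" and v :: "'m \<Rightarrow> 'd::topological_space"
  assumes u: "u \<in> borel_measurable M" and v: "v \<in> borel_measurable M"
    and Q: "countable Q" "\<And>t e. t \<in> space M \<Longrightarrow> 0 < e \<Longrightarrow> \<exists>q\<in>Q. dist q (u t) < e"
  shows "(\<lambda>t. (u t, v t)) \<in> borel_measurable M"
proof (rule borel_measurableI)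
  fix S :: "('c \<times> 'd) set" assume "open S"
  define W where "W q n = \<Union>{V. open V \<and> ball q (inverse (real (Suc n))) \<times> V \<subseteq> S}" for q n
  have eq: "(\<lambda>t. (u t, v t)) -` S \<inter> space M =
      (\<Union>q\<in>Q. \<Union>n. (u -` ball q (inverse (real (Suc n))) \<inter> space M) \<inter> (v -` W q n \<inter> space M))"
    (is "?L = ?R")
  proof
    show "?R \<subseteq> ?L" unfolding W_def by blast
    show "?L \<subseteq> ?R"
    proof
      fix t assume "t \<in> ?L"
      then have t: "t \<in> space M" "(u t, v t) \<in> S" by auto
      obtain U V where UV: "open U" "open V" "u t \<in> U" "v t \<in> V" "U \<times> V \<subseteq> S"
        using open_prod_elim[OF \<open>open S\<close> t(2)] by (metis mem_Times_iff fst_conv snd_conv)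
      obtain e where e: "0 < e" "ball (u t) e \<subseteq> U"
        using UV(1,3) open_contains_ball by blast
      obtain n where n: "inverse (real (Suc n)) < e/2"
        using reals_Archimedean[of "e/2"] e by auto
      obtain q where q: "q \<in> Q" "dist q (u t) < inverse (real (Suc n))"
        using Q(2)[OF t(1), of "inverse (real (Suc n))"] by auto
      have "ball q (inverse (real (Suc n))) \<subseteq> ball (u t) e"
      proof
        fix z assume "z \<in> ball q (inverse (real (Suc n)))"
        then show "z \<in> ball (u t) e"
          using dist_triangle2[of "u t" z q] q(2) n by (simp add: dist_commute)
      qed
      then have "v t \<in> W q n" unfolding W_def using UV e by blast
      moreover have "u t \<in> ball q (inverse (real (Suc n)))" using q by simp
      ultimately show "t \<in> ?R" using q(1) t(1) by blast
    qed
  qed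
  have "open (W q n)" for q n unfolding W_def by (rule open_Union) auto
  then show "(\<lambda>t. (u t, v t)) -` S \<inter> space M \<in> sets M"
    unfolding eq
    by (intro sets.countable_UN'[OF Q(1)] sets.countable_UN sets.Int measurable_sets[OF u] measurable_sets[OF v])
       (auto intro!: sets.countable_UN sets.Int measurable_sets[OF u] measurable_sets[OF v])
qed

lemma compact_countable_dense:
  fixes A :: "'c::metric_space set"
  assumes "compact A"
  obtains Q where "countable Q" "\<And>a e. a \<in> A \<Longrightarrow> 0 < e \<Longrightarrow> \<exists>q\<in>Q. dist q a < e"
proof -
  have "\<exists>k. finite k \<and> A \<subseteq> (\<Union>x\<in>k. ball x (inverse (real (Suc n))))" for n
    using seq_compact_imp_totally_bounded[OF compact_imp_seq_compact[OF assms]]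
    by (metis inverse_positive_iff_positive of_nat_0_less_iff zero_less_Suc)
  then obtain k where k: "\<And>n. finite (k n)" "\<And>n. A \<subseteq> (\<Union>x\<in>k n. ball x (inverse (real (Suc n))))"
    by metis
  show ?thesis
  proof
    show "countable (\<Union>n. k n)" using k(1) by (simp add: countable_finite)
    fix a e :: _ assume "a \<in> A" "0 < (e::real)"
    obtain n where "inverse (real (Suc n)) < e" using reals_Archimedean[OF \<open>0 < e\<close>] by auto
    moreover obtain q where "q \<in> k n" "dist q a < inverse (real (Suc n))"
      using k(2)[of n] \<open>a \<in> A\<close> by auto
    ultimately show "\<exists>q\<in>\<Union>n. k n. dist q a < e" by force
  qed
qed

lemma controlsD:
  assumes "b \<in> controls C"
  shows "b \<in> borel_measurable (lebesgue_on {0..})" "0 \<le> s \<Longrightarrow> b s \<in> C"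
  using assms by (auto simp: controls_def measurable_restrict_space2_iff)

lemma const_controls:
  assumes "c \<in> C"
  shows "(\<lambda>s\<in>{0..}. c) \<in> controls C"
proof -
  have "(\<lambda>s\<in>{0::real..}. c) \<in> borel_measurable (lebesgue_on {0..})
      \<longleftrightarrow> (\<lambda>_. c) \<in> borel_measurable (lebesgue_on {0::real..})"
    by (rule measurable_cong) auto
  then show ?thesis using assms by (auto simp: controls_def measurable_restrict_space2_iff)
qed

text \<open>Compactness of \<open>A\<close> provides the separability needed for the pair of controls, and the Euclidean
  space provides it for the state.\<close>

lemma borel_measurable_along_controls:
  fixes F :: "real ^ 'n \<Rightarrow> 'a::metric_space \<Rightarrow> 'b::metric_space \<Rightarrow> 'c::topological_space"
  assumes F: "continuous_on (UNIV \<times> A \<times> B) (\<lambda>(x, a, b). F x a b)" and "compact A"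
    and a: "a \<in> controls A" and b: "b \<in> controls B" and X: "continuous_on {0..} X"
  shows "(\<lambda>s. F (X s) (a s) (b s)) \<in> borel_measurable (lebesgue_on {0..})"
proof -
  obtain Q where Q: "countable Q" "\<And>a e. a \<in> A \<Longrightarrow> 0 < e \<Longrightarrow> \<exists>q\<in>Q. dist q a < e"
    using compact_countable_dense[OF \<open>compact A\<close>] by blast
  obtain R :: "(real ^ 'n) set" where R: "countable R" "\<And>U. open U \<Longrightarrow> U \<noteq> {} \<Longrightarrow> \<exists>d\<in>R. d \<in> U"
    by (rule countable_dense_setE) blast
  have ab: "(\<lambda>s. (a s, b s)) \<in> borel_measurable (lebesgue_on {0..})"
    by (rule borel_measurable_Pair_separable[OF controlsD(1)[OF a] controlsD(1)[OF b] Q(1)])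
       (use Q(2) controlsD(2)[OF a] in auto)
  have "(\<lambda>s. (X s, a s, b s)) \<in> borel_measurable (lebesgue_on {0..})"
  proof (rule borel_measurable_Pair_separable[OF _ ab R(1)])
    show "X \<in> borel_measurable (lebesgue_on {0..})"
      by (rule continuous_imp_measurable_on_sets_lebesgue[OF X]) auto
    show "\<exists>q\<in>R. dist q (X t) < e" if "0 < e" for t e
      using R(2)[of "ball (X t) e"] that by (auto simp: dist_commute)
  qed
  then have "(\<lambda>s. (X s, a s, b s)) \<in> measurable (lebesgue_on {0..}) (restrict_space borel (UNIV \<times> A \<times> B))"
    by (rule measurable_restrict_space2[rotated]) (use controlsD(2)[OF a] controlsD(2)[OF b] in auto)
  from measurable_compose[OF this borel_measurable_continuous_on_restrict[OF F]]
  show ?thesis by simp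
qed

text \<open>By periodicity all values of \<open>f\<close> are taken over the unit cube, so compactness applies.\<close>

lemma (in differential_game) f_bounded:
  obtains K where "\<And>x a b. a \<in> A \<Longrightarrow> b \<in> B \<Longrightarrow> norm (f x a b) \<le> K"
proof -
  have "compact (cbox 0 1 \<times> A \<times> B)"
    by (intro compact_Times compact_cbox compact_A compact_B)
  then have "compact ((\<lambda>(x, a, b). f x a b) ` (cbox 0 1 \<times> A \<times> B))"
    by (rule compact_continuous_image[OF continuous_on_subset[OF continuous_f], rotated]) auto
  then obtain K where K: "\<And>z. z \<in> (\<lambda>(x, a, b). f x a b) ` (cbox 0 1 \<times> A \<times> B) \<Longrightarrow> norm z \<le> K"
    using compact_imp_bounded bounded_iff by metis
  show ?thesis
  proof
    fix x :: "real ^ 'n" and a b assume ab: "a \<in> A" "b \<in> B"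
    obtain k where k: "k \<in> int_lattice" "x - k \<in> cbox 0 1" by (rule lattice_cell)
    have "f x a b = f ((x - k) + k) a b" by simp
    also have "\<dots> = f (x - k) a b"
      using periodic_f[OF ab] k(1) unfolding lattice_periodic_def by blast
    finally have "f x a b = f (x - k) a b" .
    moreover have "norm (f (x - k) a b) \<le> K"
      using k(2) ab by (intro K image_eqI[of _ _ "(x - k, a, b)"]) auto
    ultimately show "norm (f x a b) \<le> K" by simp
  qed
qed

text \<open>The dynamics satisfies the hypotheses of the existence and uniqueness theorem, so that the definite
  description in \<^const>\<open>trajectory\<close> denotes a true solution. Continuity in time makes the payoff
  integrals meaningful.\<close>

lemma (in differential_game) continuous_on_trajectory:
  assumes a: "a \<in> controls A" and b: "b \<in> controls B"
  shows "continuous_on {0..} (trajectory f x a b)"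
proof -
  obtain K where K: "\<And>x a b. a \<in> A \<Longrightarrow> b \<in> B \<Longrightarrow> norm (f x a b) \<le> K" by (rule f_bounded) blast
  obtain L where L: "0 \<le> L" "\<And>x y a b. a \<in> A \<Longrightarrow> b \<in> B \<Longrightarrow> norm (f x a b - f y a b) \<le> L * norm (x - y)"
    using lipschitz_f by blast
  have bound: "norm (f y (a s) (b s)) \<le> K" if "0 \<le> s" for s y
    using that by (intro K controlsD(2)[OF a] controlsD(2)[OF b])
  have int: "(\<lambda>s. f (X s) (a s) (b s)) integrable_on {0..t}" if "continuous_on {0..} X" "0 \<le> t" for X t
  proof (rule measurable_bounded_by_integrable_imp_integrable)
    have "(\<lambda>s. f (X s) (a s) (b s)) \<in> borel_measurable (lebesgue_on {0..})"
      by (rule borel_measurable_along_controls[OF continuous_f compact_A a b that(1)])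
    then show "(\<lambda>s. f (X s) (a s) (b s)) \<in> borel_measurable (lebesgue_on {0..t})"
      by (rule measurable_restrict_mono) auto
  qed (auto intro: bound)
  have iff: "is_trajectory f x a b X \<longleftrightarrow> X \<in> extensional {0..} \<and> continuous_on {0..} X \<and>
      (\<forall>t\<ge>0. X t = x + integral {0..t} (\<lambda>s. f (X s) (a s) (b s)))" for X
    by (rule is_trajectory_iff_integral_equation[where f = f and a = a and b = b and K = K])
       (rule int bound; assumption)+
  have "\<exists>!X. X \<in> extensional {0..} \<and> continuous_on {0..} X \<and>
      (\<forall>t\<ge>0. X t = x + integral {0..t} (\<lambda>s. f (X s) (a s) (b s)))"
    by (rule integral_equation_unique_solution[where L = L and K = K and \<phi> = "\<lambda>s y. f y (a s) (b s)"])
       (auto intro: int bound L controlsD(2)[OF a] controlsD(2)[OF b])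
  then have "is_trajectory f x a b (trajectory f x a b)"
    unfolding trajectory_def iff by (rule theI')
  then show ?thesis by (simp add: iff)
qed

section \<open>Discounted averages\<close>

text \<open>Multiplied by \<open>\<delta>\<close>, the discounted integral is an average. The weight of the times after \<open>T\<close> is
  \<open>exp (- \<delta> * T)\<close>, and there only the global bound \<open>K\<close> is available.\<close>

lemma discounted_integral_le:
  fixes h :: "real \<Rightarrow> real"
  assumes h: "h \<in> borel_measurable (lebesgue_on {0..})" and "0 < \<delta>" "0 \<le> T"
    and K: "\<And>s. 0 \<le> s \<Longrightarrow> \<bar>h s\<bar> \<le> K" and c: "\<And>s. 0 \<le> s \<Longrightarrow> s \<le> T \<Longrightarrow> h s \<le> c" "c \<le> K"
  shows "\<delta> * (LINT s:{0..}|lebesgue. exp (- \<delta> * s) * h s) \<le> c + (K - c) * exp (- \<delta> * T)"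
proof -
  have e0: "((\<lambda>s. exp (- \<delta> * s)) has_integral (1 / \<delta>)) {0..}"
    using has_integral_exp_minus_to_infinity[OF \<open>0 < \<delta>\<close>, of 0] by simp
  have "((\<lambda>s. if s \<in> {T..} then exp (- \<delta> * s) else 0) has_integral (exp (- \<delta> * T) / \<delta>)) {0..}"
    using has_integral_exp_minus_to_infinity[OF \<open>0 < \<delta>\<close>, of T] \<open>0 \<le> T\<close>
    by (subst has_integral_restrict) auto
  from has_integral_add[OF has_integral_mult_right[OF e0, of c] has_integral_mult_right[OF this, of "K - c"]]
  have up: "((\<lambda>s. c * exp (- \<delta> * s) + (K - c) * (if s \<in> {T..} then exp (- \<delta> * s) else 0))
      has_integral (c * (1 / \<delta>) + (K - c) * (exp (- \<delta> * T) / \<delta>))) {0..}" .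
  have ai: "(\<lambda>s. exp (- \<delta> * s) * h s) absolutely_integrable_on {0..}"
  proof (rule measurable_bounded_by_integrable_imp_absolutely_integrable)
    have "(\<lambda>s. exp (- \<delta> * s)) \<in> borel_measurable (lebesgue_on {0..})"
      by (rule continuous_imp_measurable_on_sets_lebesgue) (auto intro!: continuous_intros)
    then show "(\<lambda>s. exp (- \<delta> * s) * h s) \<in> borel_measurable (lebesgue_on {0..})"
      using h by (rule borel_measurable_times)
    show "(\<lambda>s. exp (- \<delta> * s) * K) integrable_on {0..}"
      using has_integral_mult_left[OF e0, of K] by blast
    show "norm (exp (- \<delta> * s) * h s) \<le> exp (- \<delta> * s) * K" if "s \<in> {0..}" for s
      using K[of s] that by (simp add: abs_mult)
  qed auto
  have "(LINT s:{0..}|lebesgue. exp (- \<delta> * s) * h s) = integral {0..} (\<lambda>s. exp (- \<delta> * s) * h s)"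
    using ai by (rule set_lebesgue_integral_eq_integral)
  also have "\<dots> \<le> c * (1 / \<delta>) + (K - c) * (exp (- \<delta> * T) / \<delta>)"
  proof (rule has_integral_le[OF integrable_integral up])
    show "(\<lambda>s. exp (- \<delta> * s) * h s) integrable_on {0..}"
      using ai by (rule set_lebesgue_integral_eq_integral)
    fix s :: real assume s: "s \<in> {0..}"
    have "h s \<le> c + (K - c) * (if s \<in> {T..} then 1 else 0)"
      using c(1)[of s] K[of s] s by auto
    then have "exp (- \<delta> * s) * h s \<le> exp (- \<delta> * s) * (c + (K - c) * (if s \<in> {T..} then 1 else 0))"
      by (intro mult_left_mono) auto
    then show "exp (- \<delta> * s) * h s
        \<le> c * exp (- \<delta> * s) + (K - c) * (if s \<in> {T..} then exp (- \<delta> * s) else 0)"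
      by (auto simp: algebra_simps split: if_splits)
  qed
  finally have "\<delta> * (LINT s:{0..}|lebesgue. exp (- \<delta> * s) * h s)
      \<le> \<delta> * (c * (1 / \<delta>) + (K - c) * (exp (- \<delta> * T) / \<delta>))"
    using \<open>0 < \<delta>\<close> by (intro mult_left_mono) auto
  also have "\<dots> = c + (K - c) * exp (- \<delta> * T)"
    using \<open>0 < \<delta>\<close> by (simp add: distrib_left)
  finally show ?thesis .
qed

lemma discount_tail_tendsto:
  fixes \<delta> :: real
  assumes "0 < \<delta>"
  shows "((\<lambda>T. c + d * exp (- \<delta> * T)) \<longlongrightarrow> c) at_top"
proof -
  have "filterlim (\<lambda>T. - \<delta> * T) at_bot at_top"
    using assms by (intro filterlim_tendsto_neg_mult_at_bot[OF tendsto_const _ filterlim_ident]) auto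
  then have "((\<lambda>T. exp (- \<delta> * T)) \<longlongrightarrow> 0) at_top"
    by (rule filterlim_compose[OF exp_at_bot])
  then have "((\<lambda>T. c + d * exp (- \<delta> * T)) \<longlongrightarrow> c + d * 0) at_top"
    by (intro tendsto_intros)
  then show ?thesis by simp
qed

section \<open>Values at points of dominions\<close>

lemma (in differential_game) controls_B_nonempty: "controls B \<noteq> {}"
  using nonempty_B const_controls by blast

context differential_game
begin

text \<open>The running payoff \<open>r\<close> is arbitrary here; it will be the original one perturbed by a function of
  the state.\<close>

context
  fixes r :: "real ^ 'n \<Rightarrow> 'a \<Rightarrow> 'b \<Rightarrow> real" and K \<delta> :: real
  assumes r_cont: "continuous_on (UNIV \<times> A \<times> B) (\<lambda>(x, a, b). r x a b)"
    and r_bound: "\<And>x a b. a \<in> A \<Longrightarrow> b \<in> B \<Longrightarrow> \<bar>r x a b\<bar> \<le> K"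
    and discount: "0 < \<delta>"
begin

lemma running_payoff_measurable:
  assumes a: "a \<in> controls A" and b: "b \<in> controls B"
  shows "(\<lambda>s. r (trajectory f x a b s) (a s) (b s)) \<in> borel_measurable (lebesgue_on {0..})"
  by (rule borel_measurable_along_controls[OF r_cont compact_A a b continuous_on_trajectory[OF a b]])

lemma payoff_le:
  assumes a: "a \<in> controls A" and b: "b \<in> controls B" and "0 \<le> T" "c \<le> K"
    and c: "\<And>t. t \<in> {0..T} \<Longrightarrow> r (trajectory f x a b t) (a t) (b t) \<le> c"
  shows "\<delta> * discounted_payoff f r \<delta> x a b \<le> c + (K - c) * exp (- \<delta> * T)"
  unfolding discounted_payoff_def
  by (rule discounted_integral_le[OF running_payoff_measurable[OF a b] discount \<open>0 \<le> T\<close>])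
     (use assms controlsD(2)[OF a] controlsD(2)[OF b] in \<open>auto intro: r_bound\<close>)

lemma payoff_ge:
  assumes a: "a \<in> controls A" and b: "b \<in> controls B" and "0 \<le> T" "- K \<le> c"
    and c: "\<And>t. t \<in> {0..T} \<Longrightarrow> c \<le> r (trajectory f x a b t) (a t) (b t)"
  shows "c - (K + c) * exp (- \<delta> * T) \<le> \<delta> * discounted_payoff f r \<delta> x a b"
proof -
  have "\<delta> * (LINT s:{0..}|lebesgue. exp (- \<delta> * s) * (- r (trajectory f x a b s) (a s) (b s)))
      \<le> - c + (K - (- c)) * exp (- \<delta> * T)"
    by (rule discounted_integral_le[OF borel_measurable_uminus[OF running_payoff_measurable[OF a b]]
          discount \<open>0 \<le> T\<close>])
       (use assms controlsD(2)[OF a] controlsD(2)[OF b] in \<open>auto intro: r_bound\<close>)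
  then show ?thesis
    by (simp add: discounted_payoff_def set_lebesgue_integral_def)
qed

lemma payoff_bounded:
  assumes a: "a \<in> controls A" and b: "b \<in> controls B"
  shows "\<bar>discounted_payoff f r \<delta> x a b\<bar> \<le> K / \<delta>"
proof -
  have r: "\<bar>r (trajectory f x a b t) (a t) (b t)\<bar> \<le> K" if "t \<in> {0..0}" for t
    using that by (intro r_bound controlsD(2)[OF a] controlsD(2)[OF b]) auto
  have "0 \<le> K" using r[of 0] by simp
  have "\<delta> * discounted_payoff f r \<delta> x a b \<le> K"
    using payoff_le[OF a b, of 0 K x] r by (auto simp: abs_le_iff)
  moreover have "- K \<le> \<delta> * discounted_payoff f r \<delta> x a b"
    using payoff_ge[OF a b, of 0 "- K" x] r \<open>0 \<le> K\<close> by (fastforce simp: abs_le_iff)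
  ultimately show ?thesis using discount by (simp add: abs_le_iff field_simps)
qed

text \<open>Suprema and infima of real numbers are meaningful only for bounded sets; the next two facts
  allow the use of their order properties for the lower value.\<close>

lemma bdd_payoffs:
  assumes "\<alpha> \<in> strategies A B"
  shows "bdd_above ((\<lambda>b. discounted_payoff f r \<delta> x (\<alpha> b) b) ` controls B)"
proof (rule bdd_aboveI2)
  fix b assume b: "b \<in> controls B"
  with assms have "\<alpha> b \<in> controls A" by (auto simp: strategies_def)
  from payoff_bounded[OF this b] show "discounted_payoff f r \<delta> x (\<alpha> b) b \<le> K / \<delta>"
    by (simp add: abs_le_iff)
qed

lemma bdd_guarantees:
  "bdd_below ((\<lambda>\<alpha>. SUP b\<in>controls B. discounted_payoff f r \<delta> x (\<alpha> b) b) ` strategies A B)"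
proof (rule bdd_belowI2)
  fix \<alpha> assume \<alpha>: "\<alpha> \<in> strategies A B"
  obtain b where b: "b \<in> controls B" using controls_B_nonempty by blast
  with \<alpha> have "\<alpha> b \<in> controls A" by (auto simp: strategies_def)
  from payoff_bounded[OF this b, of x] have "- (K / \<delta>) \<le> discounted_payoff f r \<delta> x (\<alpha> b) b"
    by (simp add: abs_le_iff)
  also have "\<dots> \<le> (SUP b\<in>controls B. discounted_payoff f r \<delta> x (\<alpha> b) b)"
    by (rule cSUP_upper[OF b bdd_payoffs[OF \<alpha>]])
  finally show "- (K / \<delta>) \<le> (SUP b\<in>controls B. discounted_payoff f r \<delta> x (\<alpha> b) b)" .
qed

text \<open>For every horizon \<open>T\<close>, player 1 can stay close to the dominion up to time \<open>T\<close>, whatever player 2 does,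
  and so keeps the running payoff below \<open>c\<close> until then. The discount rate is fixed while \<open>T\<close> tends to
  infinity, so the uncontrolled tail disappears.\<close>

lemma lower_value_le_on_dominion1:
  assumes D: "dominion1 A B f D" "x \<in> D" and "0 < \<epsilon>" "c \<le> K"
    and c: "\<And>y a b. infdist y D \<le> \<epsilon> \<Longrightarrow> a \<in> A \<Longrightarrow> b \<in> B \<Longrightarrow> r y a b \<le> c"
  shows "\<delta> * lower_value A B f r \<delta> x \<le> c"
proof (rule tendsto_lowerbound[OF discount_tail_tendsto[OF discount]])
  have "\<delta> * lower_value A B f r \<delta> x \<le> c + (K - c) * exp (- \<delta> * T)" if "0 \<le> T" for T
  proof -
    obtain \<alpha> where \<alpha>: "\<alpha> \<in> strategies A B"
      "\<And>b t. b \<in> controls B \<Longrightarrow> t \<in> {0..T} \<Longrightarrow> infdist (trajectory f x (\<alpha> b) b t) D \<le> \<epsilon>"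
      using D \<open>0 < \<epsilon>\<close> \<open>0 \<le> T\<close> unfolding dominion1_def by meson
    have "discounted_payoff f r \<delta> x (\<alpha> b) b \<le> (c + (K - c) * exp (- \<delta> * T)) / \<delta>"
      if b: "b \<in> controls B" for b
    proof -
      have a: "\<alpha> b \<in> controls A" using \<alpha>(1) b by (auto simp: strategies_def)
      have "\<delta> * discounted_payoff f r \<delta> x (\<alpha> b) b \<le> c + (K - c) * exp (- \<delta> * T)"
        by (rule payoff_le[OF a b \<open>0 \<le> T\<close> \<open>c \<le> K\<close>])
           (intro c \<alpha>(2) b controlsD(2)[OF a] controlsD(2)[OF b]; simp)
      then show ?thesis using discount by (simp add: field_simps)
    qed
    then have "(SUP b\<in>controls B. discounted_payoff f r \<delta> x (\<alpha> b) b) \<le> (c + (K - c) * exp (- \<delta> * T)) / \<delta>"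
      by (rule cSUP_least[OF controls_B_nonempty])
    then have "lower_value A B f r \<delta> x \<le> (c + (K - c) * exp (- \<delta> * T)) / \<delta>"
      unfolding lower_value_def by (rule order_trans[OF cINF_lower[OF bdd_guarantees \<alpha>(1)]])
    then show ?thesis using discount by (simp add: field_simps)
  qed
  then show "\<forall>\<^sub>F T in at_top. \<delta> * lower_value A B f r \<delta> x \<le> c + (K - c) * exp (- \<delta> * T)"
    by (rule eventually_mono[OF eventually_ge_at_top[of 0]])
qed simp

text \<open>The mirror image for player 2, who answers each strategy of player 1. An infimum over the empty set
  would carry no information, hence the assumption that player 1 has a strategy.\<close>

lemma lower_value_ge_on_dominion2:
  assumes D: "dominion2 A B f D" "x \<in> D" and "0 < \<epsilon>" "- K \<le> c" and ne: "strategies A B \<noteq> {}"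
    and c: "\<And>y a b. infdist y D \<le> \<epsilon> \<Longrightarrow> a \<in> A \<Longrightarrow> b \<in> B \<Longrightarrow> c \<le> r y a b"
  shows "c \<le> \<delta> * lower_value A B f r \<delta> x"
proof (rule tendsto_upperbound[OF discount_tail_tendsto[OF discount]])
  have "c + (- (K + c)) * exp (- \<delta> * T) \<le> \<delta> * lower_value A B f r \<delta> x" if "0 \<le> T" for T
  proof -
    have "(c - (K + c) * exp (- \<delta> * T)) / \<delta> \<le> (SUP b\<in>controls B. discounted_payoff f r \<delta> x (\<alpha> b) b)"
      if \<alpha>: "\<alpha> \<in> strategies A B" for \<alpha>
    proof -
      obtain b where b: "b \<in> controls B"
        "\<And>t. t \<in> {0..T} \<Longrightarrow> infdist (trajectory f x (\<alpha> b) b t) D \<le> \<epsilon>"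
        using D \<open>0 < \<epsilon>\<close> \<open>0 \<le> T\<close> \<alpha> unfolding dominion2_def by meson
      have a: "\<alpha> b \<in> controls A" using \<alpha> b by (auto simp: strategies_def)
      have "c - (K + c) * exp (- \<delta> * T) \<le> \<delta> * discounted_payoff f r \<delta> x (\<alpha> b) b"
        by (rule payoff_ge[OF a b(1) \<open>0 \<le> T\<close> \<open>- K \<le> c\<close>])
           (intro c b(2) controlsD(2)[OF a] controlsD(2)[OF b(1)]; simp)
      then have "(c - (K + c) * exp (- \<delta> * T)) / \<delta> \<le> discounted_payoff f r \<delta> x (\<alpha> b) b"
        using discount by (simp add: field_simps)
      then show ?thesis by (rule order_trans[OF _ cSUP_upper[OF b(1) bdd_payoffs[OF \<alpha>]]])
    qed
    then have "(c - (K + c) * exp (- \<delta> * T)) / \<delta> \<le> lower_value A B f r \<delta> x"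
      unfolding lower_value_def by (rule cINF_greatest[OF ne])
    then show ?thesis using discount by (simp add: field_simps)
  qed
  then show "\<forall>\<^sub>F T in at_top. c + (- (K + c)) * exp (- \<delta> * T) \<le> \<delta> * lower_value A B f r \<delta> x"
    by (rule eventually_mono[OF eventually_ge_at_top[of 0]])
qed simp

end

end

section \<open>Dominions in the torus intersect\<close>

theorem proposition4p6:
  fixes A :: "'a::metric_space set" and B :: "'b::metric_space set"
    and f :: "real ^ 'n \<Rightarrow> 'a \<Rightarrow> 'b \<Rightarrow> real ^ 'n"
    and l :: "real ^ 'n \<Rightarrow> 'a \<Rightarrow> 'b \<Rightarrow> real"
  assumes "differential_game A B f l"
    and "uniquely_ergodic A B f l"
  shows "\<forall>D1 D2. dominion1 A B f D1 \<and> dominion2 A B f D2 \<longrightarrow>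
           closure (torus_proj ` D1) \<inter> closure (torus_proj ` D2) \<noteq> {}"
proof (intro allI impI notI)
  fix D1 D2 assume D: "dominion1 A B f D1 \<and> dominion2 A B f D2"
    and disj: "closure (torus_proj ` D1) \<inter> closure (torus_proj ` D2) = {}"
  interpret differential_game A B f l by fact
  \<comment> \<open>The inverse image in the covering space of the dominion in the torus.\<close>
  define E where "E D = torus_proj -` closure (torus_proj ` D)" for D :: "(real ^ 'n) set"
  have E: "closed (E D)" "D \<subseteq> E D" "\<And>x k. x \<in> E D \<Longrightarrow> k \<in> int_lattice \<Longrightarrow> x + k \<in> E D" for D
    using closure_subset[of "torus_proj ` D"]
    by (auto simp: E_def closed_vimage_torus_proj torus_proj_add_lattice)
  have ne: "D1 \<noteq> {}" "D2 \<noteq> {}" using D by (auto simp: dominion1_def dominion2_def)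
  then obtain x1 x2 where x: "x1 \<in> D1" "x2 \<in> D2" by blast
  have "E D1 \<noteq> {}" "E D2 \<noteq> {}" "E D1 \<inter> E D2 = {}"
    using E(2) x disj by (blast, blast, auto simp: E_def)
  then obtain g :: "real ^ 'n \<Rightarrow> real" and \<epsilon> where g: "continuous_on UNIV g" "lattice_periodic g"
    "\<And>x. 0 \<le> g x \<and> g x \<le> 1" and "0 < \<epsilon>"
    and gE: "\<And>x. infdist x (E D1) \<le> \<epsilon> \<Longrightarrow> g x = 0" "\<And>x. infdist x (E D2) \<le> \<epsilon> \<Longrightarrow> g x = 1"
    using periodic_Urysohn[OF E(1) E(3) _ E(1) E(3)] by blast
  have gD1: "g y = 0" if "infdist y D1 \<le> \<epsilon>" for y
    using gE(1) infdist_mono[OF E(2) ne(1), of y] that by simp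
  have gD2: "g y = 1" if "infdist y D2 \<le> \<epsilon>" for y
    using gE(2) infdist_mono[OF E(2) ne(2), of y] that by simp
  obtain C where C: "\<And>x a b. a \<in> A \<Longrightarrow> b \<in> B \<Longrightarrow> \<bar>l x a b\<bar> \<le> C"
    using bounded_l unfolding bounded_iff by force
  have "0 \<le> C" using C[of _ _ x1] nonempty_A nonempty_B by (meson abs_ge_zero all_not_in_conv order_trans)
  \<comment> \<open>\<open>M\<close> exceeds the oscillation \<open>2 * C\<close> of \<open>l\<close>, so that the perturbed payoff near \<open>D2\<close> is
    larger than near \<open>D1\<close>; the excess 1 is the gap between the two values.\<close>
  define M where "M = 2 * C + 1"
  define K where "K = 3 * C + 1"
  define r where "r x a b = l x a b + M * g x" for x a b
  have Mg: "continuous_on UNIV (\<lambda>x. M * g x)" "lattice_periodic (\<lambda>x. M * g x)"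
    using g(1,2) by (auto simp: lattice_periodic_def intro!: continuous_intros)
  have r_cont: "continuous_on (UNIV \<times> A \<times> B) (\<lambda>(x, a, b). r x a b)"
  proof -
    have "continuous_on (UNIV \<times> A \<times> B) (\<lambda>z. (case z of (x, a, b) \<Rightarrow> l x a b) + M * g (fst z))"
      by (intro continuous_on_add continuous_l continuous_on_compose2[OF Mg(1)] continuous_intros) auto
    then show ?thesis by (simp add: r_def case_prod_unfold)
  qed
  have r_bound: "\<bar>r x a b\<bar> \<le> K" if "a \<in> A" "b \<in> B" for x a b
  proof -
    have "0 \<le> M * g x" "M * g x \<le> M"
      using g(3)[of x] \<open>0 \<le> C\<close> by (auto simp: M_def intro!: mult_left_le)
    then show ?thesis using C[OF that, of x] by (auto simp: r_def K_def M_def)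
  qed
  have strat: "strategies A B \<noteq> {}"
    using D x(1) unfolding dominion1_def by (metis empty_iff order_refl zero_less_one)
  have le: "\<delta> * lower_value A B f r \<delta> x1 \<le> C" if "0 < \<delta>" for \<delta>
  proof (rule lower_value_le_on_dominion1[OF r_cont r_bound that _ x(1) \<open>0 < \<epsilon>\<close>])
    show "r y a b \<le> C" if "infdist y D1 \<le> \<epsilon>" "a \<in> A" "b \<in> B" for y a b
      using C[OF that(2,3), of y] gD1[OF that(1)] by (simp add: r_def)
  qed (use D \<open>0 \<le> C\<close> in \<open>auto simp: K_def\<close>)
  have ge: "C + 1 \<le> \<delta> * lower_value A B f r \<delta> x2" if "0 < \<delta>" for \<delta>
  proof (rule lower_value_ge_on_dominion2[OF r_cont r_bound that _ x(2) \<open>0 < \<epsilon>\<close> _ strat])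
    show "C + 1 \<le> r y a b" if "infdist y D2 \<le> \<epsilon>" "a \<in> A" "b \<in> B" for y a b
      using C[OF that(2,3), of y] gD2[OF that(1)] by (simp add: r_def M_def)
  qed (use D \<open>0 \<le> C\<close> in \<open>auto simp: K_def\<close>)
  have "ergodic A B f r"
    using assms(2) Mg unfolding uniquely_ergodic_def r_def[abs_def] by blast
  then obtain c where "uniform_limit UNIV (\<lambda>\<delta> x. \<delta> * lower_value A B f r \<delta> x) (\<lambda>_. c) (at_right 0)"
    by (auto simp: ergodic_def)
  then have "\<forall>\<^sub>F \<delta> in at_right 0. \<forall>x\<in>UNIV. dist (\<delta> * lower_value A B f r \<delta> x) c < 1/2"
    by (rule uniform_limitD) simp
  then have "\<forall>\<^sub>F \<delta> in at_right 0. 0 < \<delta> \<and> (\<forall>x. dist (\<delta> * lower_value A B f r \<delta> x) c < 1/2)"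
    using eventually_at_right_less[of 0] by eventually_elim auto
  then obtain \<delta> where "0 < \<delta>" "\<And>x. dist (\<delta> * lower_value A B f r \<delta> x) c < 1/2"
    using eventually_happens'[OF trivial_limit_at_right_real] by blast
  from this(2)[of x1] this(2)[of x2] le[OF \<open>0 < \<delta>\<close>] ge[OF \<open>0 < \<delta>\<close>] show False
    unfolding dist_real_def by linarith
qed

end
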